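(* Suppose that $a\in C^2_{\mathrm p}(\mathbb{R}^2)$ satisfies $$a(\varphi,\theta)=-a(\varphi+\pi,\theta)\quad\text{for all }(\varphi,\theta)\in\mathbb{R}^2,\qquad \int_0^\pi a(s,\theta)\begin{pmatrix}\cos s\\ \sin s\end{pmatrix}ds=\begin{pmatrix}0\\0\end{pmatrix}\quad\text{for all }\theta\in\mathbb{R}.$$ Let $h:(0,\pi)\times\mathbb{R}\to\mathbb{R}$ be defined by $$h(\varphi,\theta):=-\frac{\int_0^\varphi \sin(\varphi-s)\,\partial_\theta a(s,\theta)\,ds}{\sin\varphi}.$$ Then the following hold. 1. The function $h$ can be continuously extended to $\mathbb{R}^2$, such that the extended function, again denoted by $h$, satisfies $h(\varphi,\theta)=h(\varphi+\pi,\theta)$ for all $(\varphi,\theta)\in\mathbb{R}^2$, $h(\varphi,\theta)=0$ for all $(\varphi,\theta)\in\pi\mathbb{Z}\times\mathbb{R}$, and $$(\varphi,\theta)\mapsto h(\varphi,\theta)\,\boldsymbol{W}(\theta)\in C^1_{\mathrm{p,c}}(\mathbb{R}^2).$$ 2. There exists $$r_0(a)\in\left[\|a\|_\infty,\ \|a\|_\infty+\|\partial_\theta a\|_\infty+\|\partial_\theta^2a\|_\infty\right]$$ such that for all $r\ge r_0(a)$ and all $\boldsymbol{X}_0\in\mathbb{R}^3$ the surface $\boldsymbol{X}(\mathsf{S})$, where $$\boldsymbol{X}(\varphi,\theta)=\boldsymbol{X}_0+\int_0^\varphi (r-a(s,\theta))\,\boldsymbol{V}(s,\theta)\,ds+h(\varphi,\theta)\,\boldsymbol{W}(\theta),\qquad(\ast)$$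 is the boundary of a body of constant width $2r$. 3. For $a\in C^2_{\mathrm p}(\mathbb{R}^2)$ satisfying $a(\varphi,\theta)=-a(\varphi+\pi,\theta)$ for all $(\varphi,\theta)\in\mathbb{R}^2$ and $\int_0^\pi a(s,\theta)\cos s\,ds=\int_0^\pi a(s,\theta)\sin s\,ds=0$ for all $\theta\in\mathbb{R}$, the function $h$ is the unique possibility in order that $\boldsymbol{X}$ in $(\ast)$ describes the boundary of a body of constant width $2r$: if $r\in\mathbb{R}$, $\boldsymbol{X}_0\in\mathbb{R}^3$ and $\tilde h:\mathsf{S}\to\mathbb{R}$ are such that the image of $\mathsf{S}$ under $(\varphi,\theta)\mapsto \boldsymbol{X}_0+\int_0^\varphi (r-a(s,\theta))\boldsymbol{V}(s,\theta)\,ds+\tilde h(\varphi,\theta)\boldsymbol{W}(\theta)$ is the boundary of a body of constant width $2r$, then $\tilde h=h$ on $\mathsf{S}$.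
   Context: For a compact set $G\subset\mathbb{R}^3$ the directional width in direction $\omega\in\mathbb{S}^2$ is $\boldsymbol{d}_G(\omega)=\max\{\langle\omega,x\rangle:x\in G\}-\min\{\langle\omega,x\rangle:x\in G\}$. If $G$ is convex and $\boldsymbol{d}_G(\omega)=\boldsymbol{d}_G$ is constant in $\omega$, then $G$ is called a body of constant width $\boldsymbol{d}_G$. $\mathsf{S}=[0,2\pi]\times[0,\pi]$ (pairs $(\varphi,\theta)$). Set $\boldsymbol{V}(\varphi,\theta)=(\cos\varphi\cos\theta,\ \cos\varphi\sin\theta,\ -\sin\varphi)^\top$ and $\boldsymbol{W}(\theta)=(-\sin\theta,\cos\theta,0)^\top$. A function $f:\mathbb{R}^2\to\mathbb{R}$ satisfies the periodicity conditions for $\mathbb{S}^2$ if $f(\hat\varphi,\hat\theta)=f(\varphi,\theta)$ whenever $\hat\varphi-\varphi,\ \hat\theta-\theta\in2\pi\mathbb{Z}$, and also $f(\hat\varphi,\hat\theta)=f(\varphi,\theta)$ whenever $\hat\varphi+\varphi,\ \hat\theta-\theta+\pi\in2\pi\mathbb{Z}$. It satisfies the compatibility conditions for the poles if $f(0,\theta)=f(0,0)$ and $f(\pi,\theta)=f(\pi,0)$ for all $\theta\in\mathbb{R}$. For a function space $B(\mathbb{R}^2)$, $B_{\mathrm p}(\mathbb{R}^2)$ denotes the $f\in B(\mathbb{R}^2)$ satisfying the periodicity conditions, and $B_{\mathrm{p,c}}(\mathbb{R}^2)$ those satisfying both the periodicity and the compatibility conditions; for vector-valued functions this is required of each component. $\|\cdot\|_\infty$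 is the supremum norm on $\mathbb{R}^2$. *)

theory Defs
  imports "HOL-Analysis.Analysis"
begin

section \<open>Bodies of constant width\<close>

text \<open>On nonempty compact sets, \<open>Sup\<close> and \<open>Inf\<close> below are a maximum and a minimum.\<close>

definition directional_width :: "(real^3) set \<Rightarrow> real^3 \<Rightarrow> real" where
  "directional_width G \<omega> = (SUP x\<in>G. \<omega> \<bullet> x) - (INF x\<in>G. \<omega> \<bullet> x)"

text \<open>The interior of a body may be empty: a single point is a body of constant width \<open>0\<close>.\<close>

definition constant_width_body :: "(real^3) set \<Rightarrow> real \<Rightarrow> bool" where
  "constant_width_body G d \<longleftrightarrow>
     compact G \<and> G \<noteq> {} \<and> convex G \<and> (\<forall>\<omega>\<in>sphere 0 1. directional_width G \<omega> = d)"

definition is_boundary_of_constant_width_body :: "(real^3) set \<Rightarrow> real \<Rightarrow> bool" where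
  "is_boundary_of_constant_width_body B d \<longleftrightarrow> (\<exists>G. constant_width_body G d \<and> B = frontier G)"


section \<open>Function spaces in the spherical coordinates $(\varphi,\theta)$\<close>

definition partial_phi :: "(real \<times> real \<Rightarrow> real) \<Rightarrow> real \<times> real \<Rightarrow> real" where
  "partial_phi f = (\<lambda>(\<phi>, \<theta>). deriv (\<lambda>t. f (t, \<theta>)) \<phi>)"

definition partial_theta :: "(real \<times> real \<Rightarrow> real) \<Rightarrow> real \<times> real \<Rightarrow> real" where
  "partial_theta f = (\<lambda>(\<phi>, \<theta>). deriv (\<lambda>t. f (\<phi>, t)) \<theta>)"

text \<open>Differentiability is required explicitly because \<open>deriv\<close> is a total operator.\<close>

fun C_k :: "nat \<Rightarrow> (real \<times> real \<Rightarrow> real) set" where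
  "C_k 0 = {f. continuous_on UNIV f}"
| "C_k (Suc k) =
     {f. f differentiable_on UNIV \<and> partial_phi f \<in> C_k k \<and> partial_theta f \<in> C_k k}"

definition two_pi_ints :: "real set" where
  "two_pi_ints = range (\<lambda>k::int. 2 * pi * of_int k)"

definition sphere_periodic :: "(real \<times> real \<Rightarrow> real) \<Rightarrow> bool" where
  "sphere_periodic f \<longleftrightarrow>
     (\<forall>\<phi> \<theta> \<phi>' \<theta>'. \<phi>' - \<phi> \<in> two_pi_ints \<and> \<theta>' - \<theta> \<in> two_pi_ints \<longrightarrow> f (\<phi>', \<theta>') = f (\<phi>, \<theta>)) \<and>
     (\<forall>\<phi> \<theta> \<phi>' \<theta>'. \<phi>' + \<phi> \<in> two_pi_ints \<and> \<theta>' - \<theta> + pi \<in> two_pi_ints \<longrightarrow> f (\<phi>', \<theta>') = f (\<phi>, \<theta>))"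

definition pole_compatible :: "(real \<times> real \<Rightarrow> real) \<Rightarrow> bool" where
  "pole_compatible f \<longleftrightarrow> (\<forall>\<theta>. f (0, \<theta>) = f (0, 0) \<and> f (pi, \<theta>) = f (pi, 0))"

definition C_k_p :: "nat \<Rightarrow> (real \<times> real \<Rightarrow> real) set" where
  "C_k_p k = {f \<in> C_k k. sphere_periodic f}"

definition C_k_pc :: "nat \<Rightarrow> (real \<times> real \<Rightarrow> real) set" where
  "C_k_pc k = {f \<in> C_k k. sphere_periodic f \<and> pole_compatible f}"

definition C_k_pc_vec :: "nat \<Rightarrow> (real \<times> real \<Rightarrow> real^3) set" where
  "C_k_pc_vec k = {F. \<forall>i. (\<lambda>p. F p $ i) \<in> C_k_pc k}"

text \<open>A genuine supremum on bounded functions only; continuous functions satisfying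
  \<open>sphere_periodic\<close> are bounded.\<close>

definition sup_norm :: "(real \<times> real \<Rightarrow> real) \<Rightarrow> real" where
  "sup_norm f = (SUP p. \<bar>f p\<bar>)"


section \<open>The parametrization\<close>

definition param_domain :: "(real \<times> real) set" where
  "param_domain = {0..2 * pi} \<times> {0..pi}"

definition vecV :: "real \<Rightarrow> real \<Rightarrow> real^3" where
  "vecV \<phi> \<theta> = vector [cos \<phi> * cos \<theta>, cos \<phi> * sin \<theta>, - sin \<phi>]"

definition vecW :: "real \<Rightarrow> real^3" where
  "vecW \<theta> = vector [- sin \<theta>, cos \<theta>, 0]"

text \<open>Meaningful only for \<open>0 < \<phi> < pi\<close>.\<close>

definition h_formula :: "(real \<times> real \<Rightarrow> real) \<Rightarrow> real \<Rightarrow> real \<Rightarrow> real" where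
  "h_formula a \<phi> \<theta> =
     - (integral {0..\<phi>} (\<lambda>s. sin (\<phi> - s) * partial_theta a (s, \<theta>)) / sin \<phi>)"

definition surface_param ::
  "(real \<times> real \<Rightarrow> real) \<Rightarrow> (real \<times> real \<Rightarrow> real) \<Rightarrow> real \<Rightarrow> real^3 \<Rightarrow> real \<times> real \<Rightarrow> real^3" where
  "surface_param a h r X0 = (\<lambda>(\<phi>, \<theta>).
     X0 + integral {0..\<phi>} (\<lambda>s. (r - a (s, \<theta>)) *\<^sub>R vecV s \<theta>) + h (\<phi>, \<theta>) *\<^sub>R vecW \<theta>)"

end

theory Submission
  imports Defs
begin

text \<open>
  Write \<open>U(\<phi>, \<theta>)\<close> for the unit vector with spherical coordinates \<open>(\<phi>, \<theta>)\<close>, so that \<open>\<partial>U/\<partial>\<phi> = V\<close> and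
  \<open>\<partial>U/\<partial>\<theta> = sin \<phi> \<sqdot> W\<close>. For every choice of \<open>h\<close> the surface satisfies \<open>X \<bullet> U = p\<close> with
  \<open>p = X0 \<bullet> U + r (1 - cos \<phi>) - A\<close>, where \<open>A(\<phi>, \<theta>)\<close> is the integral of \<open>sin (\<phi> - s) a(s, \<theta>)\<close> over
  \<open>{0..\<phi>}\<close>. The hypotheses on \<open>a\<close> make \<open>A\<close> an odd function on the sphere, so \<open>p(u) + p(- u) = 2 r\<close>.
  The given \<open>h\<close> is the one for which \<open>X\<close> is the gradient of \<open>p\<close>, extended homogeneously of degree one.

  If \<open>p\<close> is known to be a support function, everything else follows from its differentiability: the
  body has width \<open>2 r\<close>, and by \<open>face_unique\<close> the support plane with normal \<open>u\<close> touches it in the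
  single point \<open>X(u)\<close>. Conversely, if an arbitrary coefficient of \<open>W\<close> yields the boundary of a body of
  width \<open>2 r\<close>, then \<open>X \<bullet> U = p\<close> shows that the support function of the body is at least \<open>p\<close>;
  comparing widths gives equality, and the same lemma identifies the coefficient (\<open>h_unique\<close>).

  That \<open>p\<close> is a support function for large \<open>r\<close> means \<open>X(v) \<bullet> u \<le> X(u) \<bullet> u\<close> for all \<open>u, v\<close>
  (\<open>surf_inner_le\<close>). Let \<open>v\<close> move to \<open>u\<close> along a great circle. The velocity of
  \<open>X(v)\<close> is orthogonal to \<open>v\<close>, and therefore the derivative of \<open>X(v) \<bullet> u\<close> is a nonnegative sine times
  a curvature term. Great circles through the poles are meridians, where that term is \<open>r - a\<close>. All others avoid the poles,
  where \<open>p\<close> need not be twice differentiable, and their curvature term is controlled by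
  \<open>curvature_nonneg\<close> when \<open>r\<close> is at least the sum of the norms of \<open>a\<close> and its first two
  \<open>\<theta>\<close>-derivatives. The bounds needed there gain factors \<open>sin \<phi>\<close> from the vanishing of the moments of
  \<open>a\<close> (\<open>balanced_bounds\<close>).

  Near \<open>\<phi> = 0\<close> the coefficient \<open>h\<close> is \<open>\<phi>\<close> times a continuous average of \<open>\<partial>a/\<partial>\<theta>\<close>, its
  \<open>\<theta>\<close>-derivative is \<open>\<phi>\<close> times such an average of \<open>\<partial>\<^sup>2a/\<partial>\<theta>\<^sup>2\<close>, and its \<open>\<phi>\<close>-derivative is again a
  continuous average of \<open>\<partial>a/\<partial>\<theta>\<close>. Together with \<open>pi\<close>-periodicity in \<open>\<phi>\<close>
  this gives the regularity of \<open>h\<close>.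
\<close>

section \<open>Primitives depending on a parameter, and functions with continuous partial derivatives\<close>

text \<open>The signed integral of \<open>f\<close> from \<open>0\<close> to \<open>x\<close>, for \<open>x\<close> of either sign. Rescaling to the fixed
interval \<open>{0..1}\<close> makes joint continuity and differentiation in a parameter instances of the
standard theorems on parameter integrals.\<close>

definition primitive :: "(real \<Rightarrow> real) \<Rightarrow> real \<Rightarrow> real" where
  "primitive f x = x * integral {0..1} (\<lambda>t. f (x * t))"

lemma primitive_0 [simp]: "primitive f 0 = 0"
  by (simp add: primitive_def)

lemma primitive_unique_local:
  assumes F: "\<And>y. \<bar>y\<bar> < R \<Longrightarrow> (F has_real_derivative f y) (at y)" and x: "\<bar>x\<bar> < R"
  shows "primitive f x = F x - F 0"
proof -
  have "((\<lambda>t. x * f (x * t)) has_integral (F (x * 1) - F (x * 0))) {0..1}"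
  proof (rule fundamental_theorem_of_calculus)
    fix t :: real assume t: "t \<in> {0..1}"
    have "\<bar>x * t\<bar> \<le> \<bar>x\<bar> * 1"
      using t by (simp only: abs_mult, intro mult_left_mono) auto
    then have "(F has_real_derivative f (x * t)) (at (x * t))"
      using F x by simp
    then have "((\<lambda>t. F (x * t)) has_real_derivative f (x * t) * x) (at t)"
      by (rule DERIV_chain2) (auto intro!: derivative_eq_intros)
    then show "((\<lambda>t. F (x * t)) has_vector_derivative x * f (x * t)) (at t within {0..1})"
      by (auto simp: has_real_derivative_iff_has_vector_derivative mult.commute
          intro: has_vector_derivative_at_within)
  qed simp
  from integral_unique[OF this] show ?thesis
    by (simp add: primitive_def)
qed

lemma primitive_unique:
  assumes "\<And>y. (F has_real_derivative f y) (at y)"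
  shows "primitive f x = F x - F 0"
  by (rule primitive_unique_local[of "\<bar>x\<bar> + 1"]) (use assms in auto)

lemma DERIV_primitive:
  assumes "continuous_on UNIV f"
  shows "(primitive f has_real_derivative f x) (at x)"
proof -
  define R where "R = \<bar>x\<bar> + 1"
  define F where "F = (\<lambda>u. integral {-R..u} f)"
  have F: "(F has_vector_derivative f y) (at y within {-R..R})" if "y \<in> {-R..R}" for y
    unfolding F_def
    by (rule integral_has_vector_derivative[OF continuous_on_subset[OF assms subset_UNIV] that])
  have F': "(F has_real_derivative f y) (at y)" if "\<bar>y\<bar> < R" for y
  proof -
    have y: "y \<in> {-R<..<R}" using that by (simp add: abs_less_iff)
    then have "(F has_vector_derivative f y) (at y within {-R<..<R})"
      by (intro has_vector_derivative_within_subset[OF F]) (simp_all add: subset_eq)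
    then show ?thesis
      using y by (simp add: at_within_open[of y "{-R<..<R}"] has_real_derivative_iff_has_vector_derivative)
  qed
  have eq: "primitive f y = F y - F 0" if "y \<in> {-R<..<R}" for y
    by (rule primitive_unique_local[of R]) (use F' that in auto)
  have "((\<lambda>y. F y - F 0) has_real_derivative f x) (at x)"
    using F'[of x] by (auto simp: R_def intro!: derivative_eq_intros)
  then show ?thesis
    by (rule has_field_derivative_transform_within_open[of _ _ _ "{-R<..<R}"])
       (auto simp: eq R_def)
qed

lemma has_integral_primitive:
  assumes "continuous_on UNIV f" "0 \<le> x"
  shows "(f has_integral primitive f x) {0..x}"
proof -
  have "(f has_integral (primitive f x - primitive f 0)) {0..x}"
    using assms(2)
    by (intro fundamental_theorem_of_calculus)
       (auto simp flip: has_real_derivative_iff_has_vector_derivative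
         intro: DERIV_primitive[OF assms(1)] has_field_derivative_at_within)
  then show ?thesis by simp
qed

lemma primitive_shift:
  assumes "continuous_on UNIV f"
  shows "primitive f (x + c) = primitive f c + primitive (\<lambda>s. f (s + c)) x"
proof -
  have "((\<lambda>y. primitive f (y + c)) has_real_derivative f (y + c)) (at y)" for y
    by (rule DERIV_cong[OF DERIV_chain2[OF DERIV_primitive[OF assms]]])
       (auto intro!: derivative_eq_intros)
  from primitive_unique[of "\<lambda>y. primitive f (y + c)", OF this, of x] show ?thesis by simp
qed

lemma primitive_minus_arg:
  assumes "continuous_on UNIV f"
  shows "primitive f (- x) = - primitive (\<lambda>s. f (- s)) x"
proof -
  have "((\<lambda>y. - primitive f (- y)) has_real_derivative f (- y)) (at y)" for y
    by (rule DERIV_cong[OF DERIV_minus[OF DERIV_chain2[OF DERIV_primitive[OF assms]]]])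
       (auto intro!: derivative_eq_intros)
  from primitive_unique[of "\<lambda>y. - primitive f (- y)", OF this, of x] show ?thesis by simp
qed

lemma primitive_uminus: "primitive (\<lambda>s. - f s) x = - primitive f x"
  by (simp add: primitive_def)

lemma abs_primitive_le:
  assumes "continuous_on UNIV f" "continuous_on UNIV g" "0 \<le> x"
    and "\<And>s. 0 \<le> s \<Longrightarrow> s \<le> x \<Longrightarrow> \<bar>f s\<bar> \<le> g s"
  shows "\<bar>primitive f x\<bar> \<le> primitive g x"
  using integral_norm_bound_integral[of f "{0..x}" g] assms
    has_integral_primitive[OF assms(1,3)] has_integral_primitive[OF assms(2,3)]
  by (auto simp: integral_unique has_integral_integrable)

lemma primitive_cos [simp]: "primitive cos x = sin x"
  by (subst primitive_unique[where F = sin]) (auto intro: DERIV_sin)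

lemma primitive_sin [simp]: "primitive sin x = 1 - cos x"
  by (subst primitive_unique[where F = "\<lambda>x. - cos x"]) (auto intro!: derivative_eq_intros)

lemma continuous_on_primitive_param:
  fixes f :: "real \<Rightarrow> real \<Rightarrow> real"
  assumes "continuous_on UNIV (\<lambda>p. f (fst p) (snd p))"
  shows "continuous_on UNIV (\<lambda>p. primitive (\<lambda>s. f s (snd p)) (fst p))"
proof -
  have "continuous_on (UNIV \<times> cbox 0 1) (\<lambda>(p, t). f (fst p * t) (snd p))"
    unfolding case_prod_beta
    by (intro continuous_on_compose2[OF assms, of _ "\<lambda>q. (fst (fst q) * snd q, snd (fst q))", simplified]
        continuous_intros) 
  from integral_continuous_on_param[OF this]
  show ?thesis unfolding primitive_def by (auto intro!: continuous_intros)
qed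

lemma DERIV_primitive_param:
  fixes f g :: "real \<Rightarrow> real \<Rightarrow> real"
  assumes f: "continuous_on UNIV (\<lambda>p. f (fst p) (snd p))"
    and g: "continuous_on UNIV (\<lambda>p. g (fst p) (snd p))"
    and fg: "\<And>s \<theta>. ((\<lambda>\<theta>. f s \<theta>) has_real_derivative g s \<theta>) (at \<theta>)"
  shows "((\<lambda>\<theta>. primitive (\<lambda>s. f s \<theta>) \<phi>) has_real_derivative primitive (\<lambda>s. g s \<theta>) \<phi>) (at \<theta>)"
proof -
  have "((\<lambda>\<theta>. integral (cbox 0 1) (\<lambda>t. f (\<phi> * t) \<theta>)) has_real_derivative
          integral (cbox 0 1) (\<lambda>t. g (\<phi> * t) \<theta>)) (at \<theta> within UNIV)"
  proof (rule leibniz_rule_field_derivative)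
    show "continuous_on (UNIV \<times> cbox 0 1) (\<lambda>(\<theta>, t). g (\<phi> * t) \<theta>)"
      unfolding case_prod_beta
      by (intro continuous_on_compose2[OF g, of _ "\<lambda>q. (\<phi> * snd q, fst q)", simplified]
          continuous_intros)
    show "(\<lambda>t. f (\<phi> * t) x) integrable_on cbox 0 1" for x
      by (intro integrable_continuous
          continuous_on_compose2[OF f, of _ "\<lambda>t. (\<phi> * t, x)", simplified] continuous_intros)
  qed (use fg in auto)
  from DERIV_cmult[OF this, of \<phi>] show ?thesis by (simp add: primitive_def)
qed

lemma has_derivative_partials:
  fixes F D E :: "real \<Rightarrow> real \<Rightarrow> real"
  assumes D: "\<And>x y. ((\<lambda>x. F x y) has_real_derivative D x y) (at x)"
    and E: "\<And>x y. ((\<lambda>y. F x y) has_real_derivative E x y) (at y)"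
    and cont: "continuous_on UNIV (\<lambda>p. E (fst p) (snd p))"
  shows "((\<lambda>p. F (fst p) (snd p)) has_derivative (\<lambda>q. D x y * fst q + E x y * snd q)) (at (x, y))"
proof -
  have "((\<lambda>(x, y). F x y) has_derivative
      (\<lambda>(tx, ty). D x y * tx + blinfun_scaleR_right (E x y) ty)) (at (x, y) within UNIV \<times> UNIV)"
  proof (rule has_derivative_partialsI)
    show "((\<lambda>x. F x y) has_derivative (*) (D x y)) (at x)"
      using D by (simp add: has_field_derivative_def)
    show "((\<lambda>y. F x y) has_derivative blinfun_apply (blinfun_scaleR_right (E x y))) (at y)" for x y
      using E[unfolded has_field_derivative_def] by (simp add: scaleR_conv_of_real[abs_def])
    show "continuous (at (x, y) within UNIV \<times> UNIV) (\<lambda>(x, y). blinfun_scaleR_right (E x y))"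
      using cont unfolding case_prod_beta UNIV_Times_UNIV
      by (auto intro!: continuous_intros simp: continuous_on_eq_continuous_within)
  qed auto
  then show ?thesis by (simp add: case_prod_beta')
qed

lemma DERIV_partials_chain:
  fixes F D E :: "real \<Rightarrow> real \<Rightarrow> real"
  assumes D: "\<And>x y. ((\<lambda>x. F x y) has_real_derivative D x y) (at x)"
    and E: "\<And>x y. ((\<lambda>y. F x y) has_real_derivative E x y) (at y)"
    and cont: "continuous_on UNIV (\<lambda>p. E (fst p) (snd p))"
    and u: "(u has_real_derivative u') (at t)"
  shows "((\<lambda>t. F (u t) t) has_real_derivative D (u t) t * u' + E (u t) t) (at t)"
proof -
  have "((\<lambda>t. (u t, t)) has_derivative (\<lambda>h. (u' * h, h))) (at t)"
    using u by (auto intro!: derivative_eq_intros simp: has_field_derivative_def)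
  from has_derivative_compose[OF this has_derivative_partials[OF D E cont]]
  have "((\<lambda>t. F (u t) t) has_derivative (\<lambda>h. D (u t) t * (u' * h) + E (u t) t * h)) (at t)"
    by simp
  then show ?thesis
    unfolding has_field_derivative_def by (rule has_derivative_eq_rhs) (auto simp: algebra_simps)
qed

text \<open>Continuous partial derivatives suffice for membership in \<open>C_k 1\<close>. Below, functions of the two
coordinates are curried, which lets the partial derivatives be taken one argument at a time.\<close>

lemma C_k_1_I:
  fixes F D E :: "real \<Rightarrow> real \<Rightarrow> real"
  assumes D: "\<And>x y. ((\<lambda>x. F x y) has_real_derivative D x y) (at x)"
    and E: "\<And>x y. ((\<lambda>y. F x y) has_real_derivative E x y) (at y)"
    and contD: "continuous_on UNIV (\<lambda>p. D (fst p) (snd p))"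
    and contE: "continuous_on UNIV (\<lambda>p. E (fst p) (snd p))"
  shows "(\<lambda>p. F (fst p) (snd p)) \<in> C_k 1"
proof -
  have "(\<lambda>p. F (fst p) (snd p)) differentiable_on UNIV"
    using has_derivative_partials[OF D E contE]
    by (auto simp: differentiable_on_def differentiable_def)
  moreover have "partial_phi (\<lambda>p. F (fst p) (snd p)) = (\<lambda>p. D (fst p) (snd p))"
    using D by (auto simp: partial_phi_def DERIV_imp_deriv fun_eq_iff)
  moreover have "partial_theta (\<lambda>p. F (fst p) (snd p)) = (\<lambda>p. E (fst p) (snd p))"
    using E by (auto simp: partial_theta_def DERIV_imp_deriv fun_eq_iff)
  ultimately show ?thesis
    using contD contE by simp
qed

lemma partial_theta_DERIV:
  assumes "f differentiable_on UNIV"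
  shows "((\<lambda>t. f (\<phi>, t)) has_real_derivative partial_theta f (\<phi>, \<theta>)) (at \<theta>)"
proof -
  have "(\<lambda>t. f (\<phi>, t)) differentiable at \<theta>"
  proof (rule differentiable_compose[of f "\<lambda>t. (\<phi>, t)", unfolded o_def])
    show "f differentiable at (\<phi>, \<theta>)" using assms by (simp add: differentiable_on_def)
    show "(\<lambda>t. (\<phi>, t)) differentiable at \<theta>"
      by (auto simp: differentiable_def intro!: exI derivative_eq_intros)
  qed
  then show ?thesis
    by (simp add: partial_theta_def DERIV_deriv_iff_real_differentiable)
qed

section \<open>Sine and cosine moments of antipodally odd functions\<close>

lemma periodic_int_shift:
  fixes g :: "real \<Rightarrow> 'a"
  assumes "\<And>x. g (x + p) = g x"
  shows "g (x + of_int k * p) = g x"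
proof -
  interpret periodic_fun_simple g p by unfold_locales (rule assms)
  show ?thesis by (rule plus_of_int)
qed

text \<open>The moments of \<open>f\<close> along a meridian: the integrals of \<open>f (s, \<theta>) * cos s\<close> and of
\<open>f (s, \<theta>) * sin s\<close> for \<open>s\<close> from \<open>0\<close> to \<open>\<phi>\<close>, which is allowed to be negative.\<close>

definition cos_prim :: "(real \<times> real \<Rightarrow> real) \<Rightarrow> real \<Rightarrow> real \<Rightarrow> real" where
  "cos_prim f \<phi> \<theta> = primitive (\<lambda>s. f (s, \<theta>) * cos s) \<phi>"

definition sin_prim :: "(real \<times> real \<Rightarrow> real) \<Rightarrow> real \<Rightarrow> real \<Rightarrow> real" where
  "sin_prim f \<phi> \<theta> = primitive (\<lambda>s. f (s, \<theta>) * sin s) \<phi>"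

text \<open>The symmetries shared by \<open>a\<close> and its \<open>\<theta>\<close>-derivatives: antipodal oddness, invariance under the
change of coordinates \<open>(\<phi>, \<theta>) \<mapsto> (- \<phi>, \<theta> + pi)\<close>, which describes the same point of the sphere, and
vanishing of both moments over a half meridian. Periodicity \<open>2 * pi\<close> in each variable follows.\<close>

definition balanced :: "(real \<times> real \<Rightarrow> real) \<Rightarrow> bool" where
  "balanced f \<longleftrightarrow> continuous_on UNIV f \<and>
     (\<forall>\<phi> \<theta>. f (\<phi> + pi, \<theta>) = - f (\<phi>, \<theta>)) \<and> (\<forall>\<phi> \<theta>. f (- \<phi>, \<theta> + pi) = f (\<phi>, \<theta>)) \<and>
     (\<forall>\<theta>. cos_prim f pi \<theta> = 0) \<and> (\<forall>\<theta>. sin_prim f pi \<theta> = 0)"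

lemma balancedD:
  assumes "balanced f"
  shows "continuous_on UNIV f" "f (\<phi> + pi, \<theta>) = - f (\<phi>, \<theta>)" "f (- \<phi>, \<theta> + pi) = f (\<phi>, \<theta>)"
    "cos_prim f pi \<theta> = 0" "sin_prim f pi \<theta> = 0"
  using assms by (auto simp: balanced_def)

lemma cos_prim_0 [simp]: "cos_prim f 0 \<theta> = 0"
  and sin_prim_0 [simp]: "sin_prim f 0 \<theta> = 0"
  by (simp_all add: cos_prim_def sin_prim_def)

context
  fixes f :: "real \<times> real \<Rightarrow> real"
  assumes cont: "continuous_on UNIV f"
begin

lemma cont_times_cos: "continuous_on UNIV (\<lambda>p. f (fst p, snd p) * cos (fst p))"
  and cont_times_sin: "continuous_on UNIV (\<lambda>p. f (fst p, snd p) * sin (fst p))"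
  using cont by (auto intro!: continuous_intros)

lemma cont_slice: "continuous_on S (\<lambda>s. f (u s, v s))" if "continuous_on S u" "continuous_on S v"
  by (rule continuous_on_compose2[OF cont]) (auto intro!: continuous_intros that)

lemma cont_slice_cos: "continuous_on UNIV (\<lambda>s. f (s, \<theta>) * cos s)"
  and cont_slice_sin: "continuous_on UNIV (\<lambda>s. f (s, \<theta>) * sin s)"
  by (auto intro!: continuous_intros cont_slice)

lemma DERIV_cos_prim_phi: "((\<lambda>x. cos_prim f x \<theta>) has_real_derivative f (\<phi>, \<theta>) * cos \<phi>) (at \<phi>)"
  unfolding cos_prim_def by (rule DERIV_primitive[OF cont_slice_cos])

lemma DERIV_sin_prim_phi: "((\<lambda>x. sin_prim f x \<theta>) has_real_derivative f (\<phi>, \<theta>) * sin \<phi>) (at \<phi>)"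
  unfolding sin_prim_def by (rule DERIV_primitive[OF cont_slice_sin])

lemma continuous_on_cos_prim: "continuous_on UNIV (\<lambda>p. cos_prim f (fst p) (snd p))"
  unfolding cos_prim_def
  by (rule continuous_on_primitive_param[of "\<lambda>s \<theta>. f (s, \<theta>) * cos s"]) (rule cont_times_cos)

lemma continuous_on_sin_prim: "continuous_on UNIV (\<lambda>p. sin_prim f (fst p) (snd p))"
  unfolding sin_prim_def
  by (rule continuous_on_primitive_param[of "\<lambda>s \<theta>. f (s, \<theta>) * sin s"]) (rule cont_times_sin)

lemma has_integral_cos_prim: "0 \<le> \<phi> \<Longrightarrow> ((\<lambda>s. f (s, \<theta>) * cos s) has_integral cos_prim f \<phi> \<theta>) {0..\<phi>}"
  unfolding cos_prim_def by (rule has_integral_primitive[OF cont_slice_cos])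

lemma has_integral_sin_prim: "0 \<le> \<phi> \<Longrightarrow> ((\<lambda>s. f (s, \<theta>) * sin s) has_integral sin_prim f \<phi> \<theta>) {0..\<phi>}"
  unfolding sin_prim_def by (rule has_integral_primitive[OF cont_slice_sin])

end

lemma DERIV_cos_prim_theta:
  assumes "continuous_on UNIV f" "continuous_on UNIV g"
    and "\<And>\<phi> \<theta>. ((\<lambda>t. f (\<phi>, t)) has_real_derivative g (\<phi>, \<theta>)) (at \<theta>)"
  shows "((\<lambda>t. cos_prim f \<phi> t) has_real_derivative cos_prim g \<phi> \<theta>) (at \<theta>)"
  unfolding cos_prim_def
  by (rule DERIV_primitive_param[of "\<lambda>s \<theta>. f (s, \<theta>) * cos s" "\<lambda>s \<theta>. g (s, \<theta>) * cos s"])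
     (use assms in \<open>auto intro!: derivative_eq_intros continuous_intros\<close>)

lemma DERIV_sin_prim_theta:
  assumes "continuous_on UNIV f" "continuous_on UNIV g"
    and "\<And>\<phi> \<theta>. ((\<lambda>t. f (\<phi>, t)) has_real_derivative g (\<phi>, \<theta>)) (at \<theta>)"
  shows "((\<lambda>t. sin_prim f \<phi> t) has_real_derivative sin_prim g \<phi> \<theta>) (at \<theta>)"
  unfolding sin_prim_def
  by (rule DERIV_primitive_param[of "\<lambda>s \<theta>. f (s, \<theta>) * sin s" "\<lambda>s \<theta>. g (s, \<theta>) * sin s"])
     (use assms in \<open>auto intro!: derivative_eq_intros continuous_intros\<close>)

text \<open>Oddness of \<open>f\<close> is compensated by that of the cosine and sine, so the moments are \<open>pi\<close>-periodic
in \<open>\<phi>\<close>; this is where the vanishing of the half-meridian moments enters.\<close>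

lemma cos_prim_plus_pi:
  assumes "balanced f" shows "cos_prim f (\<phi> + pi) \<theta> = cos_prim f \<phi> \<theta>"
  using primitive_shift[OF cont_slice_cos[OF balancedD(1)[OF assms], of \<theta>], of \<phi> pi]
    balancedD(4)[OF assms, of \<theta>]
  by (simp add: cos_prim_def balancedD(2)[OF assms])

lemma sin_prim_plus_pi:
  assumes "balanced f" shows "sin_prim f (\<phi> + pi) \<theta> = sin_prim f \<phi> \<theta>"
  using primitive_shift[OF cont_slice_sin[OF balancedD(1)[OF assms], of \<theta>], of \<phi> pi]
    balancedD(5)[OF assms, of \<theta>]
  by (simp add: sin_prim_def balancedD(2)[OF assms])

lemma cos_prim_flip:
  assumes "balanced f" shows "cos_prim f (- \<phi>) (\<theta> + pi) = - cos_prim f \<phi> \<theta>"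
  using primitive_minus_arg[OF cont_slice_cos[OF balancedD(1)[OF assms]], of "\<theta> + pi" \<phi>]
  by (simp add: cos_prim_def balancedD(3)[OF assms])

lemma sin_prim_flip:
  assumes "balanced f" shows "sin_prim f (- \<phi>) (\<theta> + pi) = sin_prim f \<phi> \<theta>"
  using primitive_minus_arg[OF cont_slice_sin[OF balancedD(1)[OF assms]], of "\<theta> + pi" \<phi>]
  by (simp add: sin_prim_def balancedD(3)[OF assms] primitive_uminus)

text \<open>All conditions in \<open>balanced\<close> survive differentiation in \<open>\<theta>\<close>; hence \<open>a\<close>, \<open>\<partial>a/\<partial>\<theta>\<close> and
\<open>\<partial>\<^sup>2a/\<partial>\<theta>\<^sup>2\<close> can be treated alike.\<close>

lemma balanced_DERIV:
  assumes f: "balanced f" and g: "continuous_on UNIV g"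
    and d: "\<And>\<phi> \<theta>. ((\<lambda>t. f (\<phi>, t)) has_real_derivative g (\<phi>, \<theta>)) (at \<theta>)"
  shows "balanced g"
  unfolding balanced_def
proof (intro conjI allI)
  note fc = balancedD(1)[OF f]
  show "continuous_on UNIV g" by fact
  fix \<phi> \<theta>
  have "((\<lambda>t. f (\<phi> + pi, t)) has_real_derivative - g (\<phi>, \<theta>)) (at \<theta>)"
    using DERIV_minus[OF d[of \<phi> \<theta>]] by (simp add: balancedD(2)[OF f])
  then show "g (\<phi> + pi, \<theta>) = - g (\<phi>, \<theta>)"
    using d DERIV_unique by blast
  have "((\<lambda>t. f (- \<phi>, t + pi)) has_real_derivative g (- \<phi>, \<theta> + pi)) (at \<theta>)"
    using d[of "- \<phi>" "\<theta> + pi"] by (simp add: DERIV_shift)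
  then show "g (- \<phi>, \<theta> + pi) = g (\<phi>, \<theta>)"
    using d[of \<phi> \<theta>] DERIV_unique by (simp add: balancedD(3)[OF f]) blast
  show "cos_prim g pi \<theta> = 0"
    using DERIV_cos_prim_theta[OF fc g d, of pi \<theta>] DERIV_unique[OF _ DERIV_const]
    by (simp add: balancedD(4)[OF f])
  show "sin_prim g pi \<theta> = 0"
    using DERIV_sin_prim_theta[OF fc g d, of pi \<theta>] DERIV_unique[OF _ DERIV_const]
    by (simp add: balancedD(5)[OF f])
qed

lemma balanced_plus_2pi_theta:
  assumes "balanced f" shows "f (\<phi>, \<theta> + 2 * pi) = f (\<phi>, \<theta>)"
  using balancedD(3)[OF assms, of "- \<phi>" "\<theta> + pi"] balancedD(3)[OF assms, of \<phi> \<theta>]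
  by (simp add: algebra_simps)

lemma balanced_le_sup_norm:
  assumes f: "balanced f" shows "\<bar>f p\<bar> \<le> sup_norm f"
proof -
  let ?K = "{0..pi} \<times> {0..2 * pi}"
  have "compact ((\<lambda>p. \<bar>f p\<bar>) ` ?K)"
    by (intro compact_continuous_image continuous_intros compact_Times compact_Icc
        continuous_on_subset[OF balancedD(1)[OF f]]) auto
  then have bdd: "bdd_above ((\<lambda>p. \<bar>f p\<bar>) ` ?K)"
    by (simp add: bounded_imp_bdd_above compact_imp_bounded)
  have "\<bar>f p\<bar> \<in> (\<lambda>p. \<bar>f p\<bar>) ` ?K" for p
  proof -
    obtain \<phi> \<theta> where p: "p = (\<phi>, \<theta>)" by (cases p)
    define k where "k = - \<lfloor>\<phi> / pi\<rfloor>"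
    define l where "l = - \<lfloor>\<theta> / (2 * pi)\<rfloor>"
    have 1: "\<bar>f (\<phi> + of_int k * pi, \<theta>')\<bar> = \<bar>f (\<phi>, \<theta>')\<bar>" for \<theta>'
      by (rule periodic_int_shift[of "\<lambda>x. \<bar>f (x, \<theta>')\<bar>"]) (simp add: balancedD(2)[OF f])
    have 2: "\<bar>f (\<phi>', \<theta> + of_int l * (2 * pi))\<bar> = \<bar>f (\<phi>', \<theta>)\<bar>" for \<phi>'
      by (rule periodic_int_shift[of "\<lambda>x. \<bar>f (\<phi>', x)\<bar>"]) (simp add: balanced_plus_2pi_theta[OF f])
    have "\<phi> + of_int k * pi \<in> {0..pi}"
      using floor_divide_lower[of pi \<phi>] floor_divide_upper[of pi \<phi>]
      by (auto simp: k_def algebra_simps)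
    moreover have "\<theta> + of_int l * (2 * pi) \<in> {0..2 * pi}"
      using floor_divide_lower[of "2 * pi" \<theta>] floor_divide_upper[of "2 * pi" \<theta>]
      by (auto simp: l_def algebra_simps)
    moreover have "\<bar>f p\<bar> = \<bar>f (\<phi> + of_int k * pi, \<theta> + of_int l * (2 * pi))\<bar>"
      by (simp only: 1 2 p)
    ultimately show ?thesis by blast
  qed
  then have "bdd_above (range (\<lambda>p. \<bar>f p\<bar>))"
    by (intro bdd_above_mono[OF bdd]) auto
  then show ?thesis
    unfolding sup_norm_def by (intro cSUP_upper) auto
qed

text \<open>The gain of a factor \<open>sin \<phi>\<close> or \<open>(sin \<phi>)\<^sup>2\<close> makes the later estimates uniform up to the poles. For
\<open>\<phi> \<le> pi / 2\<close> the kernels \<open>cos s\<close>, \<open>sin s\<close> and \<open>sin (\<phi> - s)\<close> are nonnegative, the last two have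
integral \<open>1 - cos \<phi>\<close>, and \<open>1 - cos \<phi> \<le> (sin \<phi>)\<^sup>2\<close>.\<close>

lemma prim_bounds_near_north_pole:
  assumes f: "continuous_on UNIV f" and M: "\<And>p. \<bar>f p\<bar> \<le> M" and \<phi>: "0 \<le> \<phi>" "\<phi> \<le> pi / 2"
  shows "\<bar>cos_prim f \<phi> \<theta>\<bar> \<le> M * sin \<phi>" "\<bar>sin_prim f \<phi> \<theta>\<bar> \<le> M * (sin \<phi>)\<^sup>2"
    "\<bar>sin \<phi> * cos_prim f \<phi> \<theta> - cos \<phi> * sin_prim f \<phi> \<theta>\<bar> \<le> M * (sin \<phi>)\<^sup>2"
proof -
  have M0: "0 \<le> M" using M[of undefined] by linarith
  have "1 - cos \<phi> \<le> (1 - cos \<phi>) * (1 + cos \<phi>)"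
    using \<phi> cos_ge_zero[of \<phi>] mult_left_mono[of 1 "1 + cos \<phi>" "1 - cos \<phi>"] by simp
  also have "\<dots> = (sin \<phi>)\<^sup>2"
    by (simp add: sin_squared_eq algebra_simps power2_eq_square)
  finally have vers: "M * (1 - cos \<phi>) \<le> M * (sin \<phi>)\<^sup>2"
    using M0 by (rule mult_left_mono)
  have "\<bar>cos_prim f \<phi> \<theta>\<bar> \<le> primitive (\<lambda>s. M * cos s) \<phi>"
    unfolding cos_prim_def
  proof (rule abs_primitive_le[OF cont_slice_cos[OF f]])
    fix s assume "0 \<le> s" "s \<le> \<phi>"
    then show "\<bar>f (s, \<theta>) * cos s\<bar> \<le> M * cos s"
      using \<phi> cos_ge_zero[of s] M[of "(s, \<theta>)"] by (auto simp: abs_mult intro: mult_right_mono)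
  qed (use \<phi> in \<open>auto intro!: continuous_intros\<close>)
  then show "\<bar>cos_prim f \<phi> \<theta>\<bar> \<le> M * sin \<phi>"
    by (subst (asm) primitive_unique[of "\<lambda>x. M * sin x"]) (auto intro!: derivative_eq_intros)
  have "\<bar>sin_prim f \<phi> \<theta>\<bar> \<le> primitive (\<lambda>s. M * sin s) \<phi>"
    unfolding sin_prim_def
  proof (rule abs_primitive_le[OF cont_slice_sin[OF f]])
    fix s assume "0 \<le> s" "s \<le> \<phi>"
    then show "\<bar>f (s, \<theta>) * sin s\<bar> \<le> M * sin s"
      using \<phi> sin_ge_zero[of s] M[of "(s, \<theta>)"] by (auto simp: abs_mult intro: mult_right_mono)
  qed (use \<phi> in \<open>auto intro!: continuous_intros\<close>)
  also have "primitive (\<lambda>s. M * sin s) \<phi> = M * (1 - cos \<phi>)"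
    by (subst primitive_unique[of "\<lambda>x. - M * cos x"])
       (auto intro!: derivative_eq_intros simp: algebra_simps)
  finally show "\<bar>sin_prim f \<phi> \<theta>\<bar> \<le> M * (sin \<phi>)\<^sup>2"
    using vers by linarith
  have kernel: "sin \<phi> * cos_prim f \<phi> \<theta> - cos \<phi> * sin_prim f \<phi> \<theta>
      = primitive (\<lambda>s. sin (\<phi> - s) * f (s, \<theta>)) \<phi>"
    by (subst primitive_unique[of "\<lambda>x. sin \<phi> * cos_prim f x \<theta> - cos \<phi> * sin_prim f x \<theta>"])
       (auto intro!: derivative_eq_intros DERIV_cos_prim_phi[OF f] DERIV_sin_prim_phi[OF f]
         simp: sin_diff algebra_simps)
  also have "\<bar>\<dots>\<bar> \<le> primitive (\<lambda>s. M * sin (\<phi> - s)) \<phi>"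
  proof (rule abs_primitive_le)
    fix s assume "0 \<le> s" "s \<le> \<phi>"
    then show "\<bar>sin (\<phi> - s) * f (s, \<theta>)\<bar> \<le> M * sin (\<phi> - s)"
      using \<phi> sin_ge_zero[of "\<phi> - s"] M[of "(s, \<theta>)"]
      by (auto simp: abs_mult mult.commute[of M] intro: mult_left_mono)
  qed (use \<phi> in \<open>auto intro!: continuous_intros cont_slice f\<close>)
  also have "\<dots> = M * (1 - cos \<phi>)"
    by (subst primitive_unique[of "\<lambda>x. M * cos (\<phi> - x)"])
       (auto intro!: derivative_eq_intros simp: algebra_simps)
  finally show "\<bar>sin \<phi> * cos_prim f \<phi> \<theta> - cos \<phi> * sin_prim f \<phi> \<theta>\<bar> \<le> M * (sin \<phi>)\<^sup>2"
    using vers by linarith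
qed

text \<open>For \<open>\<phi> \<ge> pi / 2\<close> the symmetries of the moments replace \<open>(\<phi>, \<theta>)\<close> by \<open>(pi - \<phi>, \<theta> + pi)\<close>, which
lies near the north pole.\<close>

lemma balanced_bounds:
  assumes f: "balanced f" and \<phi>: "0 \<le> \<phi>" "\<phi> \<le> pi"
  shows "\<bar>cos_prim f \<phi> \<theta>\<bar> \<le> sup_norm f * sin \<phi>" "\<bar>sin_prim f \<phi> \<theta>\<bar> \<le> sup_norm f * (sin \<phi>)\<^sup>2"
    "\<bar>sin \<phi> * cos_prim f \<phi> \<theta> - cos \<phi> * sin_prim f \<phi> \<theta>\<bar> \<le> sup_norm f * (sin \<phi>)\<^sup>2"
proof -
  note half = prim_bounds_near_north_pole[OF balancedD(1)[OF f] balanced_le_sup_norm[OF f]]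
  have c: "cos_prim f \<phi> \<theta> = - cos_prim f (pi - \<phi>) (\<theta> + pi)"
    using cos_prim_flip[OF f, of "\<phi> - pi" \<theta>] cos_prim_plus_pi[OF f, of "\<phi> - pi" \<theta>] by simp
  have s: "sin_prim f \<phi> \<theta> = sin_prim f (pi - \<phi>) (\<theta> + pi)"
    using sin_prim_flip[OF f, of "\<phi> - pi" \<theta>] sin_prim_plus_pi[OF f, of "\<phi> - pi" \<theta>] by simp
  have "\<phi> \<le> pi / 2 \<or> 0 \<le> pi - \<phi> \<and> pi - \<phi> \<le> pi / 2" using \<phi> by auto
  then show "\<bar>cos_prim f \<phi> \<theta>\<bar> \<le> sup_norm f * sin \<phi>" "\<bar>sin_prim f \<phi> \<theta>\<bar> \<le> sup_norm f * (sin \<phi>)\<^sup>2"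
    "\<bar>sin \<phi> * cos_prim f \<phi> \<theta> - cos \<phi> * sin_prim f \<phi> \<theta>\<bar> \<le> sup_norm f * (sin \<phi>)\<^sup>2"
    using half[of \<phi> \<theta>] \<phi>(1) half[of "pi - \<phi>" "\<theta> + pi"] by (auto simp: c s)
qed

section \<open>The tangential coefficient and its regularity at the poles\<close>

text \<open>For \<open>f = \<partial>a/\<partial>\<theta>\<close> this is the coefficient \<open>h\<close> of \<open>vecW\<close>, because the integral of
\<open>sin (\<phi> - s) * f (s, \<theta>)\<close> over \<open>{0..\<phi>}\<close> is \<open>sin \<phi> * cos_prim f \<phi> \<theta> - cos \<phi> * sin_prim f \<phi> \<theta>\<close>. The
value at the poles is the limit there.\<close>

definition tang :: "(real \<times> real \<Rightarrow> real) \<Rightarrow> real \<Rightarrow> real \<Rightarrow> real" where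
  "tang f \<phi> \<theta> = (if sin \<phi> = 0 then 0
     else (cos \<phi> * sin_prim f \<phi> \<theta> - sin \<phi> * cos_prim f \<phi> \<theta>) / sin \<phi>)"

text \<open>The \<open>\<phi>\<close>-derivative of \<open>tang f\<close>. At the poles \<open>f\<close> may depend on \<open>\<theta>\<close>; since \<open>tang f\<close> is
\<open>pi\<close>-periodic in \<open>\<phi>\<close>, one formula serves both poles although \<open>f\<close> changes sign between them.\<close>

definition tang_phi :: "(real \<times> real \<Rightarrow> real) \<Rightarrow> real \<Rightarrow> real \<Rightarrow> real" where
  "tang_phi f \<phi> \<theta> = (if sin \<phi> = 0 then - f (0, \<theta>) / 2 else - sin_prim f \<phi> \<theta> / (sin \<phi>)\<^sup>2)"

lemma tang_0 [simp]: "sin \<phi> = 0 \<Longrightarrow> tang f \<phi> \<theta> = 0"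
  by (simp add: tang_def)

lemma tang_plus_pi: "balanced f \<Longrightarrow> tang f (\<phi> + pi) \<theta> = tang f \<phi> \<theta>"
  by (simp add: tang_def cos_prim_plus_pi sin_prim_plus_pi diff_divide_distrib)

lemma tang_phi_plus_pi: "balanced f \<Longrightarrow> tang_phi f (\<phi> + pi) \<theta> = tang_phi f \<phi> \<theta>"
  by (simp add: tang_phi_def sin_prim_plus_pi)

lemma tang_flip: "balanced f \<Longrightarrow> tang f (- \<phi>) (\<theta> + pi) = - tang f \<phi> \<theta>"
  by (simp add: tang_def cos_prim_flip sin_prim_flip)

lemma abs_tang_le:
  assumes "balanced f" "0 \<le> \<phi>" "\<phi> \<le> pi"
  shows "\<bar>tang f \<phi> \<theta>\<bar> \<le> sup_norm f * sin \<phi>"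
  using balanced_bounds(3)[OF assms, of \<theta>] sin_ge_zero[OF assms(2,3)]
  by (auto simp: tang_def divide_le_eq abs_minus_commute power2_eq_square mult.assoc)

text \<open>The functions \<open>sinc\<close>, \<open>mean_cos\<close> and \<open>mean_sin\<close> are the continuous quotients of \<open>sin \<phi>\<close>,
\<open>cos_prim f \<phi> \<theta>\<close> and \<open>sin_prim f \<phi> \<theta>\<close> by \<open>\<phi>\<close>, \<open>\<phi>\<close> and \<open>\<phi>\<^sup>2\<close>, written as averages so that they
are defined at \<open>\<phi> = 0\<close> too. They remove the apparent singularity of \<open>tang f\<close> and \<open>tang_phi f\<close> there.\<close>

definition sinc :: "real \<Rightarrow> real" where
  "sinc x = integral {0..1} (\<lambda>t. cos (x * t))"

definition mean_cos :: "(real \<times> real \<Rightarrow> real) \<Rightarrow> real \<Rightarrow> real \<Rightarrow> real" where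
  "mean_cos f \<phi> \<theta> = integral {0..1} (\<lambda>t. f (\<phi> * t, \<theta>) * cos (\<phi> * t))"

definition mean_sin :: "(real \<times> real \<Rightarrow> real) \<Rightarrow> real \<Rightarrow> real \<Rightarrow> real" where
  "mean_sin f \<phi> \<theta> = integral {0..1} (\<lambda>t. t * sinc (\<phi> * t) * f (\<phi> * t, \<theta>))"

lemma sin_eq_sinc: "sin x = x * sinc x"
  using primitive_cos[of x] by (simp add: primitive_def sinc_def)

lemma continuous_on_integral_01:
  fixes f :: "'a::topological_space \<Rightarrow> real \<Rightarrow> real"
  assumes "continuous_on (UNIV \<times> {0..1}) (\<lambda>q. f (fst q) (snd q))"
  shows "continuous_on UNIV (\<lambda>x. integral {0..1} (f x))"
  using integral_continuous_on_param[of UNIV 0 1 f] assms by (simp add: case_prod_beta')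

lemma sinc_0 [simp]: "sinc 0 = 1"
  by (simp add: sinc_def)

lemma sinc_nonzero: "\<bar>x\<bar> < pi \<Longrightarrow> sinc x \<noteq> 0"
  using sin_eq_sinc[of x] sin_eq_0_pi[of x] by (cases "x = 0") (auto simp: abs_less_iff)

lemma continuous_on_sinc: "continuous_on UNIV sinc"
  unfolding sinc_def
  by (rule continuous_on_integral_01) (intro continuous_intros)

lemma cos_prim_eq_mean: "cos_prim f \<phi> \<theta> = \<phi> * mean_cos f \<phi> \<theta>"
  by (simp add: cos_prim_def primitive_def mean_cos_def)

lemma sin_prim_eq_mean: "sin_prim f \<phi> \<theta> = \<phi>\<^sup>2 * mean_sin f \<phi> \<theta>"
proof -
  have "f (\<phi> * t, \<theta>) * sin (\<phi> * t) = \<phi> * (t * sinc (\<phi> * t) * f (\<phi> * t, \<theta>))" for t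
    by (simp add: sin_eq_sinc[of "\<phi> * t"])
  then have "sin_prim f \<phi> \<theta> = \<phi> * integral {0..1} (\<lambda>t. \<phi> * (t * sinc (\<phi> * t) * f (\<phi> * t, \<theta>)))"
    by (simp only: sin_prim_def primitive_def)
  then show ?thesis
    by (simp add: mean_sin_def power2_eq_square)
qed

lemma continuous_on_mean_cos:
  assumes "continuous_on UNIV f"
  shows "continuous_on UNIV (\<lambda>p. mean_cos f (fst p) (snd p))"
  unfolding mean_cos_def
  by (rule continuous_on_integral_01) (intro continuous_intros cont_slice assms)

lemma continuous_on_mean_sin:
  assumes "continuous_on UNIV f"
  shows "continuous_on UNIV (\<lambda>p. mean_sin f (fst p) (snd p))"
  unfolding mean_sin_def
  by (rule continuous_on_integral_01)
     (intro continuous_intros cont_slice assms continuous_on_compose2[OF continuous_on_sinc] subset_UNIV)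

text \<open>A neighbourhood of the line \<open>\<phi> = 0\<close> whose translates by multiples of \<open>pi\<close> cover the plane.\<close>

definition pole_strip :: "(real \<times> real) set" where
  "pole_strip = {-pi<..<pi} \<times> UNIV"

lemma tang_strip:
  assumes "\<bar>\<phi>\<bar> < pi"
  shows "tang f \<phi> \<theta> = \<phi> * (cos \<phi> * mean_sin f \<phi> \<theta> / sinc \<phi> - mean_cos f \<phi> \<theta>)"
proof (cases "\<phi> = 0")
  case False
  define s where "s = sinc \<phi>"
  have s: "sin \<phi> = \<phi> * s" "s \<noteq> 0"
    using sinc_nonzero[OF assms] by (simp_all add: s_def sin_eq_sinc)
  then show ?thesis
    using False unfolding s_def[symmetric] tang_def cos_prim_eq_mean sin_prim_eq_mean s(1)
    by (simp add: field_simps power2_eq_square)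
qed simp

lemma mean_0:
  shows "mean_sin f 0 \<theta> = f (0, \<theta>) / 2" "mean_cos f 0 \<theta> = f (0, \<theta>)"
proof -
  have "((\<lambda>t. t * f (0, \<theta>)) has_integral (1\<^sup>2 - 0\<^sup>2) / 2 * f (0, \<theta>)) {0..1::real}"
    by (intro has_integral_mult_left ident_has_integral) simp
  then show "mean_sin f 0 \<theta> = f (0, \<theta>) / 2"
    by (simp add: mean_sin_def integral_unique)
qed (simp add: mean_cos_def)

lemma tang_phi_strip:
  assumes "\<bar>\<phi>\<bar> < pi"
  shows "tang_phi f \<phi> \<theta> = - mean_sin f \<phi> \<theta> / (sinc \<phi>)\<^sup>2"
proof (cases "\<phi> = 0")
  case True
  then show ?thesis by (simp add: tang_phi_def mean_0)
next
  case False
  define s where "s = sinc \<phi>"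
  have s: "sin \<phi> = \<phi> * s" "s \<noteq> 0"
    using sinc_nonzero[OF assms] by (simp_all add: s_def sin_eq_sinc)
  then show ?thesis
    using False unfolding s_def[symmetric] tang_phi_def sin_prim_eq_mean s(1)
    by (simp add: power_mult_distrib)
qed

lemma continuous_on_from_strip:
  fixes g :: "real \<Rightarrow> real \<Rightarrow> real"
  assumes cont: "continuous_on pole_strip (\<lambda>p. g (fst p) (snd p))"
    and per: "\<And>\<phi> \<theta>. g (\<phi> + pi) \<theta> = g \<phi> \<theta>"
  shows "continuous_on UNIV (\<lambda>p. g (fst p) (snd p))"
  unfolding continuous_on_eq_continuous_at[OF open_UNIV]
proof
  fix p :: "real \<times> real"
  define k where "k = - \<lfloor>fst p / pi\<rfloor>"
  define u where "u = (\<lambda>q :: real \<times> real. (fst q + of_int k * pi, snd q))"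
  have "0 \<le> fst p + of_int k * pi" "fst p + of_int k * pi < pi"
    using floor_divide_lower[of pi "fst p"] floor_divide_upper[of pi "fst p"]
    by (simp_all add: k_def algebra_simps)
  then have "u p \<in> pole_strip"
    using pi_gt_zero by (simp add: pole_strip_def u_def del: pi_gt_zero)
  moreover have "open pole_strip"
    by (auto simp: pole_strip_def intro: open_Times)
  ultimately have "isCont (\<lambda>p. g (fst p) (snd p)) (u p)"
    using cont continuous_on_eq_continuous_at by blast
  moreover have "isCont u p"
    unfolding u_def by (intro continuous_intros)
  ultimately have "isCont (\<lambda>q. g (fst (u q)) (snd (u q))) p"
    by (rule isCont_o2[of _ u, rotated])
  then show "isCont (\<lambda>q. g (fst q) (snd q)) p"
    by (simp add: u_def periodic_int_shift[of "\<lambda>x. g x _", OF per])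
qed

lemma strip_sinc: "continuous_on pole_strip (\<lambda>p. sinc (fst p))" "\<And>p. p \<in> pole_strip \<Longrightarrow> sinc (fst p) \<noteq> 0"
  by (auto simp: pole_strip_def abs_less_iff intro!: sinc_nonzero continuous_intros
      continuous_on_compose2[OF continuous_on_sinc])

lemma continuous_on_tang:
  assumes "balanced f"
  shows "continuous_on UNIV (\<lambda>p. tang f (fst p) (snd p))"
proof (rule continuous_on_from_strip)
  note fc = balancedD(1)[OF assms]
  have "continuous_on pole_strip (\<lambda>p. fst p * (cos (fst p) * mean_sin f (fst p) (snd p) / sinc (fst p)
      - mean_cos f (fst p) (snd p)))"
    using strip_sinc
    by (intro continuous_intros continuous_on_subset[OF continuous_on_mean_sin[OF fc]]
        continuous_on_subset[OF continuous_on_mean_cos[OF fc]]) auto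
  then show "continuous_on pole_strip (\<lambda>p. tang f (fst p) (snd p))"
    by (subst continuous_on_cong[OF refl tang_strip]) (auto simp: pole_strip_def)
qed (rule tang_plus_pi[OF assms])

lemma continuous_on_tang_phi:
  assumes "balanced f"
  shows "continuous_on UNIV (\<lambda>p. tang_phi f (fst p) (snd p))"
proof (rule continuous_on_from_strip)
  note fc = balancedD(1)[OF assms]
  have "continuous_on pole_strip (\<lambda>p. - mean_sin f (fst p) (snd p) / (sinc (fst p))\<^sup>2)"
    using strip_sinc
    by (intro continuous_intros continuous_on_subset[OF continuous_on_mean_sin[OF fc]]) auto
  then show "continuous_on pole_strip (\<lambda>p. tang_phi f (fst p) (snd p))"
    by (subst continuous_on_cong[OF refl tang_phi_strip]) (auto simp: pole_strip_def)
qed (rule tang_phi_plus_pi[OF assms])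

lemma DERIV_tang_theta:
  assumes "continuous_on UNIV f" "continuous_on UNIV g"
    and "\<And>\<phi> \<theta>. ((\<lambda>t. f (\<phi>, t)) has_real_derivative g (\<phi>, \<theta>)) (at \<theta>)"
  shows "((\<lambda>t. tang f \<phi> t) has_real_derivative tang g \<phi> \<theta>) (at \<theta>)"
  unfolding tang_def
  by (auto intro!: derivative_eq_intros DERIV_sin_prim_theta[OF assms] DERIV_cos_prim_theta[OF assms])

lemma DERIV_tang_phi:
  assumes f: "balanced f"
  shows "((\<lambda>x. tang f x \<theta>) has_real_derivative tang_phi f \<phi> \<theta>) (at \<phi>)"
proof (cases "sin \<phi> = 0")
  case False
  note fc = balancedD(1)[OF f]
  let ?g = "\<lambda>x. (cos x * sin_prim f x \<theta> - sin x * cos_prim f x \<theta>) / sin x"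
  have "(?g has_real_derivative
     ((- sin \<phi> * sin_prim f \<phi> \<theta> - cos \<phi> * cos_prim f \<phi> \<theta>) * sin \<phi>
      - (cos \<phi> * sin_prim f \<phi> \<theta> - sin \<phi> * cos_prim f \<phi> \<theta>) * cos \<phi>) / (sin \<phi> * sin \<phi>)) (at \<phi>)"
    by (auto intro!: derivative_eq_intros DERIV_sin_prim_phi[OF fc] DERIV_cos_prim_phi[OF fc] False
        simp: algebra_simps)
  also have "(- sin \<phi> * sin_prim f \<phi> \<theta> - cos \<phi> * cos_prim f \<phi> \<theta>) * sin \<phi>
      - (cos \<phi> * sin_prim f \<phi> \<theta> - sin \<phi> * cos_prim f \<phi> \<theta>) * cos \<phi>
      = - sin_prim f \<phi> \<theta> * ((sin \<phi>)\<^sup>2 + (cos \<phi>)\<^sup>2)"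
    by (simp only: power2_eq_square) algebra
  finally have "(?g has_real_derivative tang_phi f \<phi> \<theta>) (at \<phi>)"
    using False by (simp add: tang_phi_def power2_eq_square[of "sin \<phi>", symmetric])
  then show ?thesis
  proof (rule has_field_derivative_transform_within_open)
    show "open {x :: real. sin x \<noteq> 0}"
      by (intro open_Collect_neq continuous_intros)
  qed (use False in \<open>auto simp: tang_def\<close>)
next
  case True
  then obtain k where k: "\<phi> = of_int k * pi"
    using sin_zero_iff_int2 by blast
  \<comment> \<open>Since \<open>tang f x \<theta> = x * q x\<close> with \<open>q\<close> continuous, the derivative at \<open>0\<close> is \<open>q 0\<close>.\<close>
  have "((\<lambda>x. tang f x \<theta>) has_real_derivative tang_phi f 0 \<theta>) (at 0)"
  proof -
    define q where "q = (\<lambda>x. cos x * mean_sin f x \<theta> / sinc x - mean_cos f x \<theta>)"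
    have "isCont q 0"
    proof -
      have "isCont sinc 0" "isCont (\<lambda>x. mean_sin f x \<theta>) 0" "isCont (\<lambda>x. mean_cos f x \<theta>) 0"
        using continuous_on_sinc continuous_on_compose2[OF continuous_on_mean_sin[OF balancedD(1)[OF f]], of UNIV "\<lambda>x. (x, \<theta>)"]
          continuous_on_compose2[OF continuous_on_mean_cos[OF balancedD(1)[OF f]], of UNIV "\<lambda>x. (x, \<theta>)"]
        by (auto simp: continuous_on_eq_continuous_at intro!: continuous_intros)
      then show ?thesis unfolding q_def by (auto intro!: continuous_intros)
    qed
    then have "(q \<longlongrightarrow> q 0) (at 0)" by (simp add: isCont_def)
    then have "((\<lambda>x. tang f x \<theta> / x) \<longlongrightarrow> q 0) (at 0)"
    proof (rule Lim_transform_within_open)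
      show "q x = tang f x \<theta> / x" if "x \<in> {-pi<..<pi}" "x \<noteq> 0" for x
        using that by (subst tang_strip) (auto simp: q_def abs_less_iff)
    qed auto
    then show ?thesis
      by (simp add: has_field_derivative_iff q_def mean_0 tang_phi_def)
  qed
  then have "((\<lambda>x. tang f (x + of_int (- k) * pi) \<theta>) has_real_derivative tang_phi f 0 \<theta>) (at \<phi>)"
    using DERIV_shift[of "\<lambda>x. tang f x \<theta>" _ \<phi> "of_int (- k) * pi"] by (simp add: k)
  moreover have "tang_phi f 0 \<theta> = tang_phi f \<phi> \<theta>"
    using True by (simp add: tang_phi_def)
  ultimately show ?thesis
    by (simp only: periodic_int_shift[of "\<lambda>x. tang f x \<theta>", OF tang_plus_pi[OF f]])
qed

section \<open>Spherical coordinates, the surface and its support function\<close>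

lemma inner_real3: "(x :: real^3) \<bullet> y = x $ 1 * y $ 1 + x $ 2 * y $ 2 + x $ 3 * y $ 3"
  by (simp add: inner_vec_def sum_3)

text \<open>The unit normal in spherical coordinates. It satisfies \<open>\<partial>U/\<partial>\<phi> = V\<close> and
\<open>\<partial>U/\<partial>\<theta> = sin \<phi> \<sqdot> W\<close>, and \<open>U, V, W\<close> is an orthonormal frame.\<close>

definition vecU :: "real \<Rightarrow> real \<Rightarrow> real^3" where
  "vecU \<phi> \<theta> = vector [sin \<phi> * cos \<theta>, sin \<phi> * sin \<theta>, cos \<phi>]"

lemmas vec_simps = vecU_def vecV_def vecW_def inner_real3 vector_3 vector_add_component

lemma vecU_sym:
  shows "vecU (\<phi> + 2 * pi) \<theta> = vecU \<phi> \<theta>" "vecU (- \<phi>) (\<theta> + pi) = vecU \<phi> \<theta>"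
    "vecU (\<phi> + pi) \<theta> = - vecU \<phi> \<theta>"
  by (simp_all add: vec_eq_iff forall_3 vec_simps)

lemma norm_vecU: "norm (vecU \<phi> \<theta>) = 1"
proof -
  have "vecU \<phi> \<theta> \<bullet> vecU \<phi> \<theta> = (sin \<phi>)\<^sup>2 * ((cos \<theta>)\<^sup>2 + (sin \<theta>)\<^sup>2) + (cos \<phi>)\<^sup>2"
    unfolding vec_simps by algebra
  then show ?thesis by (simp add: norm_eq_1)
qed

lemma unit_eq_vecU:
  assumes "norm \<omega> = 1" obtains \<phi> \<theta> where "\<omega> = vecU \<phi> \<theta>"
proof -
  have n: "(\<omega> $ 1)\<^sup>2 + (\<omega> $ 2)\<^sup>2 + (\<omega> $ 3)\<^sup>2 = 1"
    using assms by (simp add: norm_eq_1 inner_real3 power2_eq_square)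
  define s where "s = sqrt ((\<omega> $ 1)\<^sup>2 + (\<omega> $ 2)\<^sup>2)"
  have s2: "s\<^sup>2 = (\<omega> $ 1)\<^sup>2 + (\<omega> $ 2)\<^sup>2" by (simp add: s_def)
  have "s\<^sup>2 + (\<omega> $ 3)\<^sup>2 = 1" using n s2 by simp
  then obtain \<phi> where \<phi>: "s = sin \<phi>" "\<omega> $ 3 = cos \<phi>"
    using sincos_total_2pi[of "\<omega> $ 3" s] by (metis add.commute)
  obtain \<theta> where "\<omega> $ 1 = s * cos \<theta>" "\<omega> $ 2 = s * sin \<theta>"
  proof (cases "s = 0")
    case True
    then show ?thesis using s2 that[of 0] by (simp add: sum_power2_eq_zero_iff)
  next
    case False
    then have "(\<omega> $ 1 / s)\<^sup>2 + (\<omega> $ 2 / s)\<^sup>2 = 1"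
      using s2 by (simp add: power_divide flip: add_divide_distrib s2)
    then obtain \<theta> where "\<omega> $ 1 / s = cos \<theta>" "\<omega> $ 2 / s = sin \<theta>"
      using sincos_total_2pi[of "\<omega> $ 1 / s" "\<omega> $ 2 / s"] by metis
    then show ?thesis using False that[of \<theta>] by (simp add: field_simps)
  qed
  then have "\<omega> = vecU \<phi> \<theta>"
    using \<phi> by (simp add: vec_eq_iff forall_3 vec_simps)
  then show ?thesis by (rule that)
qed

text \<open>Invariance of a curried function under the changes of coordinates that fix the point of the
sphere. Applied to pairs \<open>(vecU \<phi> \<theta>, F \<phi> \<theta>)\<close>, it allows the coordinates to be normalized without
changing either component.\<close>

definition sphere_inv :: "(real \<Rightarrow> real \<Rightarrow> 'a) \<Rightarrow> bool" where
  "sphere_inv F \<longleftrightarrow> (\<forall>\<phi> \<theta>. F (\<phi> + 2 * pi) \<theta> = F \<phi> \<theta>) \<and> (\<forall>\<phi> \<theta>. F (- \<phi>) (\<theta> + pi) = F \<phi> \<theta>)"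

lemma sphere_invD:
  assumes "sphere_inv F"
  shows "F (\<phi> + 2 * pi) \<theta> = F \<phi> \<theta>" "F (- \<phi>) (\<theta> + pi) = F \<phi> \<theta>" "F \<phi> (\<theta> + 2 * pi) = F \<phi> \<theta>"
proof -
  show 1: "F (\<phi> + 2 * pi) \<theta> = F \<phi> \<theta>" and 2: "F (- \<phi>) (\<theta> + pi) = F \<phi> \<theta>"
    using assms by (simp_all add: sphere_inv_def)
  have "F (- (- \<phi>)) (\<theta> + pi + pi) = F (- \<phi>) (\<theta> + pi)"
    using assms by (simp only: sphere_inv_def)
  then show "F \<phi> (\<theta> + 2 * pi) = F \<phi> \<theta>"
    by (simp add: 2 add.assoc)
qed

lemma sphere_inv_shift:
  assumes "sphere_inv F"
  shows "F (\<phi> + of_int k * (2 * pi)) \<theta> = F \<phi> \<theta>" "F \<phi> (\<theta> + of_int k * (2 * pi)) = F \<phi> \<theta>"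
proof -
  show "F (\<phi> + of_int k * (2 * pi)) \<theta> = F \<phi> \<theta>"
    by (rule periodic_int_shift[of "\<lambda>x. F x \<theta>"]) (rule sphere_invD[OF assms])
  show "F \<phi> (\<theta> + of_int k * (2 * pi)) = F \<phi> \<theta>"
    by (rule periodic_int_shift[of "\<lambda>x. F \<phi> x"]) (rule sphere_invD[OF assms])
qed

lemma shift_2pi_into:
  obtains k :: int where "y \<le> x + of_int k * (2 * pi)" "x + of_int k * (2 * pi) < y + 2 * pi"
proof
  show "y \<le> x + of_int (- \<lfloor>(x - y) / (2 * pi)\<rfloor>) * (2 * pi)"
    using floor_divide_lower[of "2 * pi" "x - y"] by (simp add: algebra_simps)
  show "x + of_int (- \<lfloor>(x - y) / (2 * pi)\<rfloor>) * (2 * pi) < y + 2 * pi"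
    using floor_divide_upper[of "2 * pi" "x - y"] by (simp add: algebra_simps)
qed

lemma sphere_inv_reduce_phi:
  assumes F: "sphere_inv F"
  obtains \<phi>' \<theta>' where "0 \<le> \<phi>'" "\<phi>' \<le> pi" "\<bar>\<theta>' - \<theta>1\<bar> \<le> pi" "F \<phi>' \<theta>' = F \<phi> \<theta>"
proof -
  obtain k where k: "0 \<le> \<phi> + of_int k * (2 * pi)" "\<phi> + of_int k * (2 * pi) < 0 + 2 * pi"
    by (rule shift_2pi_into)
  define x where "x = \<phi> + of_int k * (2 * pi)"
  have x: "F x \<theta> = F \<phi> \<theta>" "0 \<le> x" "x < 2 * pi"
    using k sphere_inv_shift(1)[OF F] by (simp_all add: x_def)
  obtain \<phi>' \<theta>' where 1: "0 \<le> \<phi>'" "\<phi>' \<le> pi" "F \<phi>' \<theta>' = F \<phi> \<theta>"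
  proof (cases "x \<le> pi")
    case True then show ?thesis using x that by blast
  next
    case False
    have "F (- x + 2 * pi) (\<theta> + pi) = F x \<theta>"
      by (simp only: sphere_invD[OF F])
    then show ?thesis using that[of "- x + 2 * pi" "\<theta> + pi"] x False by simp
  qed
  obtain l where l: "\<theta>1 - pi \<le> \<theta>' + of_int l * (2 * pi)" "\<theta>' + of_int l * (2 * pi) < \<theta>1 - pi + 2 * pi"
    by (rule shift_2pi_into)
  show ?thesis
    by (rule that[of \<phi>' "\<theta>' + of_int l * (2 * pi)"])
       (use 1 l sphere_inv_shift(2)[OF F] in \<open>auto simp: abs_le_iff\<close>)
qed

lemma sphere_inv_reduce:
  assumes F: "sphere_inv F"
  obtains \<phi>' \<theta>' where "(\<phi>', \<theta>') \<in> param_domain" "F \<phi>' \<theta>' = F \<phi> \<theta>"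
proof -
  obtain k where k: "0 \<le> \<theta> + of_int k * (2 * pi)" "\<theta> + of_int k * (2 * pi) < 0 + 2 * pi"
    by (rule shift_2pi_into)
  define y where "y = \<theta> + of_int k * (2 * pi)"
  have y: "F \<phi> y = F \<phi> \<theta>" "0 \<le> y" "y < 2 * pi"
    using k sphere_inv_shift(2)[OF F] by (simp_all add: y_def)
  obtain \<phi>' \<theta>' where 1: "0 \<le> \<theta>'" "\<theta>' \<le> pi" "F \<phi>' \<theta>' = F \<phi> \<theta>"
  proof (cases "y \<le> pi")
    case True then show ?thesis using y that by blast
  next
    case False
    have "F (- \<phi>) (y - pi) = F \<phi> y"
      using sphere_invD(2)[OF F, of "- \<phi>" "y - pi"] by simp
    then show ?thesis using that[of "y - pi" "- \<phi>"] y False by simp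
  qed
  obtain l where l: "0 \<le> \<phi>' + of_int l * (2 * pi)" "\<phi>' + of_int l * (2 * pi) < 0 + 2 * pi"
    by (rule shift_2pi_into)
  show ?thesis
    by (rule that[of "\<phi>' + of_int l * (2 * pi)" \<theta>'])
       (use 1 l sphere_inv_shift(1)[OF F] in \<open>auto simp: param_domain_def\<close>)
qed

text \<open>The surface with an arbitrary value \<open>\<eta>\<close> in place of \<open>h (\<phi>, \<theta>)\<close>, with the integral evaluated
through the moments of \<open>a\<close>. Unlike \<open>surface_param\<close> it is meaningful for negative \<open>\<phi>\<close>.\<close>

definition surf :: "(real \<times> real \<Rightarrow> real) \<Rightarrow> real \<Rightarrow> real^3 \<Rightarrow> real \<Rightarrow> real \<Rightarrow> real \<Rightarrow> real^3" where
  "surf a r X0 \<eta> \<phi> \<theta> = X0 + vector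
     [(r * sin \<phi> - cos_prim a \<phi> \<theta>) * cos \<theta> - \<eta> * sin \<theta>,
      (r * sin \<phi> - cos_prim a \<phi> \<theta>) * sin \<theta> + \<eta> * cos \<theta>,
      - (r * (1 - cos \<phi>) - sin_prim a \<phi> \<theta>)]"

text \<open>The support function, read in direction \<open>vecU \<phi> \<theta>\<close>.\<close>

definition supp :: "(real \<times> real \<Rightarrow> real) \<Rightarrow> real \<Rightarrow> real^3 \<Rightarrow> real \<Rightarrow> real \<Rightarrow> real" where
  "supp a r X0 \<phi> \<theta> = X0 \<bullet> vecU \<phi> \<theta> + r * (1 - cos \<phi>)
     - (sin \<phi> * cos_prim a \<phi> \<theta> - cos \<phi> * sin_prim a \<phi> \<theta>)"

lemma surface_param_eq_surf:
  assumes a: "continuous_on UNIV a" and \<phi>: "0 \<le> \<phi>"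
  shows "surface_param a h r X0 (\<phi>, \<theta>) = surf a r X0 (h (\<phi>, \<theta>)) \<phi> \<theta>"
proof -
  let ?E = "vector [cos \<theta>, sin \<theta>, 0] :: real^3" and ?N = "vector [0, 0, - 1] :: real^3"
  have "((\<lambda>s. r * cos s) has_integral r * sin \<phi>) {0..\<phi>}" "((\<lambda>s. r * sin s) has_integral r * (1 - cos \<phi>)) {0..\<phi>}"
    using has_integral_primitive[OF continuous_on_cos[OF continuous_on_id] \<phi>]
      has_integral_primitive[OF continuous_on_sin[OF continuous_on_id] \<phi>]
    by (auto intro!: has_integral_mult_right)
  then have "((\<lambda>s. (r * cos s - a (s, \<theta>) * cos s) *\<^sub>R ?E + (r * sin s - a (s, \<theta>) * sin s) *\<^sub>R ?N) has_integral
      (r * sin \<phi> - cos_prim a \<phi> \<theta>) *\<^sub>R ?E + (r * (1 - cos \<phi>) - sin_prim a \<phi> \<theta>) *\<^sub>R ?N) {0..\<phi>}"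
    by (intro has_integral_add has_integral_scaleR_left has_integral_diff
        has_integral_cos_prim[OF a \<phi>] has_integral_sin_prim[OF a \<phi>])
  also have "(\<lambda>s. (r * cos s - a (s, \<theta>) * cos s) *\<^sub>R ?E + (r * sin s - a (s, \<theta>) * sin s) *\<^sub>R ?N)
      = (\<lambda>s. (r - a (s, \<theta>)) *\<^sub>R vecV s \<theta>)"
    by (simp add: fun_eq_iff vec_eq_iff forall_3 vec_simps algebra_simps)
  finally have "integral {0..\<phi>} (\<lambda>s. (r - a (s, \<theta>)) *\<^sub>R vecV s \<theta>) =
      (r * sin \<phi> - cos_prim a \<phi> \<theta>) *\<^sub>R ?E + (r * (1 - cos \<phi>) - sin_prim a \<phi> \<theta>) *\<^sub>R ?N"
    by (rule integral_unique)
  then show ?thesis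
    by (simp add: surface_param_def surf_def vec_eq_iff forall_3 vec_simps)
qed

text \<open>The tangential term is orthogonal to \<open>vecU\<close>, so the height of the surface point over its normal
direction does not depend on \<open>\<eta>\<close>. This is the reason for the uniqueness of \<open>h\<close>.\<close>

lemma surf_inner_vecU: "surf a r X0 \<eta> \<phi> \<theta> \<bullet> vecU \<phi> \<theta> = supp a r X0 \<phi> \<theta>"
proof -
  define C where "C = r * sin \<phi> - cos_prim a \<phi> \<theta>"
  have "surf a r X0 \<eta> \<phi> \<theta> \<bullet> vecU \<phi> \<theta> = X0 \<bullet> vecU \<phi> \<theta>
      + C * sin \<phi> * ((sin \<theta>)\<^sup>2 + (cos \<theta>)\<^sup>2) - (r * (1 - cos \<phi>) - sin_prim a \<phi> \<theta>) * cos \<phi>"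
    unfolding surf_def inner_add_left C_def[symmetric] vec_simps by algebra
  also have "\<dots> = X0 \<bullet> vecU \<phi> \<theta> + r * ((sin \<phi>)\<^sup>2 + (cos \<phi>)\<^sup>2) - r * cos \<phi>
      - (sin \<phi> * cos_prim a \<phi> \<theta> - cos \<phi> * sin_prim a \<phi> \<theta>)"
    unfolding C_def sin_cos_squared_add[of \<theta>] by algebra
  finally show ?thesis
    by (simp add: supp_def right_diff_distrib)
qed

lemma prim_pole:
  assumes f: "balanced f" and \<phi>: "sin \<phi> = 0"
  shows "cos_prim f \<phi> \<theta> = 0" "sin_prim f \<phi> \<theta> = 0"
proof -
  obtain k where k: "\<phi> = 0 + of_int k * pi"
    using \<phi> sin_zero_iff_int2 by auto
  show "cos_prim f \<phi> \<theta> = 0"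
    unfolding k by (subst periodic_int_shift[of "\<lambda>x. cos_prim f x \<theta>"]) (simp_all add: cos_prim_plus_pi[OF f])
  show "sin_prim f \<phi> \<theta> = 0"
    unfolding k by (subst periodic_int_shift[of "\<lambda>x. sin_prim f x \<theta>"]) (simp_all add: sin_prim_plus_pi[OF f])
qed

lemma sin_times_tang:
  assumes "balanced f"
  shows "sin \<phi> * tang f \<phi> \<theta> = cos \<phi> * sin_prim f \<phi> \<theta> - sin \<phi> * cos_prim f \<phi> \<theta>"
  using prim_pole[OF assms] by (simp add: tang_def)

text \<open>The data of the construction, with \<open>b\<close> and \<open>c\<close> the first and second derivative of \<open>a\<close> in \<open>\<theta>\<close>.\<close>

locale width_data =
  fixes a b c :: "real \<times> real \<Rightarrow> real"
  assumes bal_a: "balanced a"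
    and cont_b: "continuous_on UNIV b" and cont_c: "continuous_on UNIV c"
    and DERIV_a: "\<And>\<phi> \<theta>. ((\<lambda>t. a (\<phi>, t)) has_real_derivative b (\<phi>, \<theta>)) (at \<theta>)"
    and DERIV_b: "\<And>\<phi> \<theta>. ((\<lambda>t. b (\<phi>, t)) has_real_derivative c (\<phi>, \<theta>)) (at \<theta>)"
begin

lemma bal_b: "balanced b"
  by (rule balanced_DERIV[OF bal_a cont_b DERIV_a])

lemma bal_c: "balanced c"
  by (rule balanced_DERIV[OF bal_b cont_c DERIV_b])

lemmas cont_a = balancedD(1)[OF bal_a]

abbreviation X :: "real \<Rightarrow> real^3 \<Rightarrow> real \<Rightarrow> real \<Rightarrow> real^3" where
  "X r X0 \<phi> \<theta> \<equiv> surf a r X0 (tang b \<phi> \<theta>) \<phi> \<theta>"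

lemma supp_antipodal: "supp a r X0 (\<phi> + pi) \<theta> = 2 * r - supp a r X0 \<phi> \<theta>"
  by (simp add: supp_def cos_prim_plus_pi[OF bal_a] sin_prim_plus_pi[OF bal_a] vecU_sym distrib_left right_diff_distrib)

lemma prim_plus_2pi:
  assumes "balanced f"
  shows "cos_prim f (\<phi> + 2 * pi) \<theta> = cos_prim f \<phi> \<theta>" "sin_prim f (\<phi> + 2 * pi) \<theta> = sin_prim f \<phi> \<theta>"
    "tang f (\<phi> + 2 * pi) \<theta> = tang f \<phi> \<theta>"
  using cos_prim_plus_pi[OF assms, of "\<phi> + pi"] sin_prim_plus_pi[OF assms, of "\<phi> + pi"]
    tang_plus_pi[OF assms, of "\<phi> + pi"]
  by (simp_all add: cos_prim_plus_pi[OF assms] sin_prim_plus_pi[OF assms] tang_plus_pi[OF assms] add.assoc)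

lemma sphere_inv_supp: "sphere_inv (\<lambda>\<phi> \<theta>. (vecU \<phi> \<theta>, supp a r X0 \<phi> \<theta>))"
  by (simp add: sphere_inv_def vecU_sym supp_def cos_prim_flip[OF bal_a] sin_prim_flip[OF bal_a]
      prim_plus_2pi[OF bal_a])

lemma sphere_inv_surf: "sphere_inv (\<lambda>\<phi> \<theta>. (vecU \<phi> \<theta>, X r X0 \<phi> \<theta>))"
  by (simp add: sphere_inv_def vecU_sym surf_def cos_prim_flip[OF bal_a] sin_prim_flip[OF bal_a]
      prim_plus_2pi[OF bal_a] prim_plus_2pi[OF bal_b] tang_flip[OF bal_b] vec_eq_iff forall_3 vec_simps left_diff_distrib)

lemma surf_pole:
  assumes "sin \<phi> = 0" shows "X r X0 \<phi> \<theta> = X r X0 \<phi> \<theta>'"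
  using assms by (simp add: surf_def prim_pole[OF bal_a])

text \<open>The point \<open>X r X0 \<phi> \<theta>\<close> is the gradient of the support function: its components along \<open>vecV\<close> and
\<open>vecW\<close> are the partial derivatives of \<open>supp\<close>. The choice of \<open>h\<close> matters only for the second one.\<close>

lemma DERIV_supp_phi: "((\<lambda>x. supp a r X0 x \<theta>) has_real_derivative surf a r X0 \<eta> \<phi> \<theta> \<bullet> vecV \<phi> \<theta>) (at \<phi>)"
proof -
  define A where "A = a (\<phi>, \<theta>)"
  define C where "C = r * sin \<phi> - cos_prim a \<phi> \<theta>"
  have "surf a r X0 \<eta> \<phi> \<theta> \<bullet> vecV \<phi> \<theta> = X0 \<bullet> vecV \<phi> \<theta>
      + C * cos \<phi> * ((sin \<theta>)\<^sup>2 + (cos \<theta>)\<^sup>2) + (r * (1 - cos \<phi>) - sin_prim a \<phi> \<theta>) * sin \<phi>"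
    unfolding surf_def inner_add_left C_def[symmetric] vec_simps by algebra
  also have "\<dots> = X0 \<bullet> vecV \<phi> \<theta> + r * sin \<phi> - (cos \<phi> * cos_prim a \<phi> \<theta> + sin \<phi> * (A * cos \<phi>)
      - (- sin \<phi> * sin_prim a \<phi> \<theta> + cos \<phi> * (A * sin \<phi>)))"
    unfolding C_def sin_cos_squared_add by algebra
  finally have eq: "surf a r X0 \<eta> \<phi> \<theta> \<bullet> vecV \<phi> \<theta> = \<dots>" .
  show ?thesis
    unfolding eq unfolding supp_def vec_simps A_def
    by (auto intro!: derivative_eq_intros DERIV_cos_prim_phi[OF cont_a] DERIV_sin_prim_phi[OF cont_a]
        simp: algebra_simps)
qed

lemma DERIV_supp_theta:
  "((\<lambda>t. supp a r X0 \<phi> t) has_real_derivative sin \<phi> * (X r X0 \<phi> \<theta> \<bullet> vecW \<theta>)) (at \<theta>)"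
proof -
  have "sin \<phi> * (X r X0 \<phi> \<theta> \<bullet> vecW \<theta>) = sin \<phi> * (X0 \<bullet> vecW \<theta>)
     + sin \<phi> * tang b \<phi> \<theta> * ((sin \<theta>)\<^sup>2 + (cos \<theta>)\<^sup>2)"
    unfolding surf_def inner_add_left vec_simps by algebra
  also have "\<dots> = sin \<phi> * (X0 \<bullet> vecW \<theta>) - (sin \<phi> * cos_prim b \<phi> \<theta> - cos \<phi> * sin_prim b \<phi> \<theta>)"
    by (simp add: sin_times_tang[OF bal_b])
  finally have eq: "sin \<phi> * (X r X0 \<phi> \<theta> \<bullet> vecW \<theta>) = \<dots>" .
  show ?thesis
    unfolding eq unfolding supp_def vec_simps
    by (auto intro!: derivative_eq_intros DERIV_cos_prim_theta[OF cont_a cont_b DERIV_a]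
        DERIV_sin_prim_theta[OF cont_a cont_b DERIV_a] simp: algebra_simps)
qed

text \<open>A point below all support planes and lying on one of them is the gradient of the support function
in that direction: the slack \<open>supp - x \<bullet> vecU\<close> is minimal there, so both partial derivatives vanish.
At a pole the \<open>\<theta>\<close>-derivative carries no information, but the \<open>\<phi>\<close>-derivative is available along
every meridian.\<close>

lemma face_unique:
  assumes le: "\<And>\<phi> \<theta>. x \<bullet> vecU \<phi> \<theta> \<le> supp a r X0 \<phi> \<theta>" and eq: "x \<bullet> vecU \<phi> \<theta> = supp a r X0 \<phi> \<theta>"
  shows "x = X r X0 \<phi> \<theta>"
proof -
  have dV: "(X r X0 \<phi> \<theta>' - x) \<bullet> vecV \<phi> \<theta>' = 0" if "x \<bullet> vecU \<phi> \<theta>' = supp a r X0 \<phi> \<theta>'" for \<theta>'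
  proof -
    have "((\<lambda>t. x \<bullet> vecU t \<theta>') has_real_derivative x \<bullet> vecV \<phi> \<theta>') (at \<phi>)"
      unfolding vec_simps by (auto intro!: derivative_eq_intros simp: algebra_simps)
    from DERIV_local_min[OF DERIV_diff[OF DERIV_supp_phi this], of 1] le that
    show ?thesis by (simp add: inner_diff_left)
  qed
  have dW: "sin \<phi> * ((X r X0 \<phi> \<theta> - x) \<bullet> vecW \<theta>) = 0"
  proof -
    have "((\<lambda>t. x \<bullet> vecU \<phi> t) has_real_derivative sin \<phi> * (x \<bullet> vecW \<theta>)) (at \<theta>)"
      unfolding vec_simps by (auto intro!: derivative_eq_intros simp: algebra_simps)
    from DERIV_local_min[OF DERIV_diff[OF DERIV_supp_theta this], of 1] le eq
    show ?thesis by (simp add: inner_diff_left right_diff_distrib)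
  qed
  have dU: "(X r X0 \<phi> \<theta> - x) \<bullet> vecU \<phi> \<theta> = 0"
    using eq by (simp add: inner_diff_left surf_inner_vecU)
  define d where "d = X r X0 \<phi> \<theta> - x"
  have "d = 0"
  proof (cases "sin \<phi> = 0")
    case True
    then have U: "vecU \<phi> \<theta>' = vecU \<phi> \<theta>" for \<theta>' by (simp add: vecU_def)
    have "x \<bullet> vecU \<phi> \<theta>' = supp a r X0 \<phi> \<theta>'" for \<theta>'
      using eq surf_inner_vecU[of a r X0 "tang b \<phi> \<theta>" \<phi> \<theta>] surf_inner_vecU[of a r X0 "tang b \<phi> \<theta>'" \<phi> \<theta>']
        surf_pole[OF True, of r X0 \<theta> \<theta>'] by (simp add: U[of \<theta>'])
    then have "d \<bullet> vecV \<phi> \<theta>' = 0" for \<theta>'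
      using dV surf_pole[OF True, of r X0 \<theta> \<theta>'] by (simp add: d_def)
    from this[of 0] this[of "pi / 2"] have "d $ 1 = 0" "d $ 2 = 0"
      using True sin_cos_squared_add[of \<phi>] by (auto simp: vec_simps)
    moreover have "d $ 3 = 0"
      using True dU sin_cos_squared_add[of \<phi>] unfolding d_def[symmetric] by (auto simp: vec_simps)
    ultimately show ?thesis by (simp add: vec_eq_iff forall_3)
  next
    case False
    define e where "e = d $ 1 * cos \<theta> + d $ 2 * sin \<theta>"
    have 1: "e * sin \<phi> + d $ 3 * cos \<phi> = 0"
      using dU unfolding d_def[symmetric] by (simp add: vec_simps e_def algebra_simps)
    have 2: "e * cos \<phi> - d $ 3 * sin \<phi> = 0"
      using dV[OF eq] unfolding d_def[symmetric] by (simp add: vec_simps e_def algebra_simps)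
    have 3: "d $ 2 * cos \<theta> - d $ 1 * sin \<theta> = 0"
      using dW False unfolding d_def[symmetric] by (simp add: vec_simps algebra_simps)
    have "e * ((sin \<phi>)\<^sup>2 + (cos \<phi>)\<^sup>2) = 0" "d $ 3 * ((sin \<phi>)\<^sup>2 + (cos \<phi>)\<^sup>2) = 0"
      using 1 2 by algebra+
    then have e: "e = 0" and d3: "d $ 3 = 0" by simp_all
    have "d $ 1 * ((sin \<theta>)\<^sup>2 + (cos \<theta>)\<^sup>2) = 0" "d $ 2 * ((sin \<theta>)\<^sup>2 + (cos \<theta>)\<^sup>2) = 0"
      using e 3 unfolding e_def by algebra+
    then show ?thesis using d3 by (simp add: vec_eq_iff forall_3)
  qed
  then show ?thesis by (simp add: d_def)
qed

end

section \<open>The curvature estimate and convexity\<close>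

context width_data
begin

lemma sup_norm_nonneg: "0 \<le> sup_norm a" "0 \<le> sup_norm b" "0 \<le> sup_norm c"
  using balanced_le_sup_norm[OF bal_a] balanced_le_sup_norm[OF bal_b] balanced_le_sup_norm[OF bal_c]
  by (meson abs_ge_zero order_trans)+

text \<open>The inequality \<open>X(v) \<bullet> u \<le> X(u) \<bullet> u\<close> for \<open>u, v\<close> on a common meridian. Along it the derivative of
\<open>X \<bullet> u\<close> is \<open>(r - a) * sin (\<phi>1 - \<phi>)\<close>.\<close>

lemma meridian_le:
  assumes r: "sup_norm a \<le> r" and near: "\<bar>\<phi>0 - \<phi>1\<bar> \<le> pi"
  shows "X r X0 \<phi>0 \<theta> \<bullet> vecU \<phi>1 \<theta> \<le> X r X0 \<phi>1 \<theta> \<bullet> vecU \<phi>1 \<theta>"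
proof -
  define f where "f = (\<lambda>x. X0 \<bullet> vecU \<phi>1 \<theta> + (r * sin x - cos_prim a x \<theta>) * sin \<phi>1
     - (r * (1 - cos x) - sin_prim a x \<theta>) * cos \<phi>1)"
  have f: "X r X0 x \<theta> \<bullet> vecU \<phi>1 \<theta> = f x" for x
  proof -
    define C where "C = r * sin x - cos_prim a x \<theta>"
    have "X r X0 x \<theta> \<bullet> vecU \<phi>1 \<theta> = X0 \<bullet> vecU \<phi>1 \<theta> + C * sin \<phi>1 * ((sin \<theta>)\<^sup>2 + (cos \<theta>)\<^sup>2)
        - (r * (1 - cos x) - sin_prim a x \<theta>) * cos \<phi>1"
      unfolding surf_def C_def[symmetric] vec_simps by algebra
    then show ?thesis by (simp add: f_def C_def)
  qed
  have f': "(f has_real_derivative (r - a (x, \<theta>)) * sin (\<phi>1 - x)) (at x)" for x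
    unfolding f_def
    by (auto intro!: derivative_eq_intros DERIV_cos_prim_phi[OF cont_a] DERIV_sin_prim_phi[OF cont_a]
        simp: sin_diff algebra_simps)
  have \<rho>: "0 \<le> r - a p" for p
    using balanced_le_sup_norm[OF bal_a, of p] r by linarith
  have "f \<phi>0 \<le> f \<phi>1"
  proof (cases "\<phi>0 \<le> \<phi>1")
    case True
    then show ?thesis
    proof (rule DERIV_nonneg_imp_nondecreasing)
      fix x assume "\<phi>0 \<le> x" "x \<le> \<phi>1"
      then have "0 \<le> sin (\<phi>1 - x)" using near by (intro sin_ge_zero) auto
      then show "\<exists>y. (f has_real_derivative y) (at x) \<and> 0 \<le> y"
        using f' \<rho> by (blast intro: mult_nonneg_nonneg)
    qed
  next
    case False
    then have "\<phi>1 \<le> \<phi>0" by simp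
    then show ?thesis
    proof (rule DERIV_nonpos_imp_nonincreasing)
      fix x assume "\<phi>1 \<le> x" "x \<le> \<phi>0"
      then have "0 \<le> sin (x - \<phi>1)" using near by (intro sin_ge_zero) auto
      then have "sin (\<phi>1 - x) \<le> 0" using sin_minus[of "x - \<phi>1"] by simp
      then show "\<exists>y. (f has_real_derivative y) (at x) \<and> y \<le> 0"
        using f' \<rho> by (blast intro: mult_nonneg_nonpos)
    qed
  qed
  then show ?thesis by (simp add: f)
qed

lemma DERIV_tang_along:
  assumes "(u has_real_derivative u') (at t)"
  shows "((\<lambda>t. tang b (u t) t) has_real_derivative tang_phi b (u t) t * u' + tang c (u t) t) (at t)"
  by (rule DERIV_partials_chain[OF DERIV_tang_phi[OF bal_b] DERIV_tang_theta[OF cont_b cont_c DERIV_b]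
        continuous_on_tang[OF bal_c] assms])

lemma DERIV_cos_prim_along:
  assumes "(u has_real_derivative u') (at t)"
  shows "((\<lambda>t. cos_prim a (u t) t) has_real_derivative a (u t, t) * cos (u t) * u' + cos_prim b (u t) t) (at t)"
  by (rule DERIV_partials_chain[OF DERIV_cos_prim_phi[OF cont_a] DERIV_cos_prim_theta[OF cont_a cont_b DERIV_a]
        continuous_on_cos_prim[OF cont_b] assms])

lemma DERIV_sin_prim_along:
  assumes "(u has_real_derivative u') (at t)"
  shows "((\<lambda>t. sin_prim a (u t) t) has_real_derivative a (u t, t) * sin (u t) * u' + sin_prim b (u t) t) (at t)"
  by (rule DERIV_partials_chain[OF DERIV_sin_prim_phi[OF cont_a] DERIV_sin_prim_theta[OF cont_a cont_b DERIV_a]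
        continuous_on_sin_prim[OF cont_b] assms])

text \<open>The quantity estimated here is, up to a positive factor, the quadratic form of the curvature of the
surface on the velocity of a great circle, where \<open>k\<close> is the
derivative of \<open>cot \<phi>\<close> with respect to \<open>\<theta>\<close> along the circle. The bounds on the moments
bound it from below by \<open>sup_norm b * (1 - w)\<^sup>2 * sin \<phi>\<close> with \<open>w = \<bar>k\<bar> * sin \<phi>\<close>.\<close>

lemma curvature_nonneg:
  assumes r: "sup_norm a + sup_norm b + sup_norm c \<le> r" and \<phi>: "0 < \<phi>" "\<phi> < pi"
  shows "0 \<le> r * sin \<phi> - cos_prim a \<phi> \<theta> + tang c \<phi> \<theta> + (r - a (\<phi>, \<theta>)) * k\<^sup>2 * sin \<phi> ^ 3
             + 2 * k * sin_prim b \<phi> \<theta>"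
proof -
  define s where "s = sin \<phi>"
  have s: "0 < s" using \<phi> by (simp add: s_def sin_gt_zero)
  define w where "w = \<bar>k\<bar> * s"
  have 1: "cos_prim a \<phi> \<theta> \<le> sup_norm a * s"
    using balanced_bounds(1)[OF bal_a, of \<phi> \<theta>] \<phi> by (auto simp: s_def)
  have 2: "- (sup_norm c * s) \<le> tang c \<phi> \<theta>"
    using abs_tang_le[OF bal_c, of \<phi> \<theta>] \<phi> by (auto simp: s_def)
  have "\<bar>2 * k * sin_prim b \<phi> \<theta>\<bar> \<le> 2 * \<bar>k\<bar> * (sup_norm b * s\<^sup>2)"
    using balanced_bounds(2)[OF bal_b, of \<phi> \<theta>] \<phi>
    by (simp add: abs_mult s_def mult_left_mono)
  also have "\<dots> = 2 * sup_norm b * w * s"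
    by (simp add: w_def power2_eq_square)
  finally have 3: "- (2 * sup_norm b * w * s) \<le> 2 * k * sin_prim b \<phi> \<theta>"
    by linarith
  have ws: "k\<^sup>2 * s ^ 3 = w\<^sup>2 * s"
    by (simp add: w_def power_mult_distrib power2_eq_square power3_eq_cube)
  have "sup_norm b * (k\<^sup>2 * s ^ 3) \<le> (r - a (\<phi>, \<theta>)) * (k\<^sup>2 * s ^ 3)"
    using balanced_le_sup_norm[OF bal_a, of "(\<phi>, \<theta>)"] r s sup_norm_nonneg(3)
    by (intro mult_right_mono) auto
  then have 4: "sup_norm b * w\<^sup>2 * s \<le> (r - a (\<phi>, \<theta>)) * k\<^sup>2 * s ^ 3"
    by (simp only: mult.assoc ws)
  have 5: "(sup_norm a + sup_norm b + sup_norm c) * s \<le> r * s"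
    using r s by (intro mult_right_mono) auto
  have "0 \<le> sup_norm b * (1 - w)\<^sup>2 * s"
    using s sup_norm_nonneg by simp
  also have "\<dots> = sup_norm b * s + sup_norm b * w\<^sup>2 * s - 2 * sup_norm b * w * s"
    by algebra
  also have "\<dots> \<le> r * s - cos_prim a \<phi> \<theta> + tang c \<phi> \<theta> + (r - a (\<phi>, \<theta>)) * k\<^sup>2 * s ^ 3
             + 2 * k * sin_prim b \<phi> \<theta>"
    using 1 2 3 4 5 unfolding distrib_right by linarith
  finally show ?thesis by (simp only: s_def)
qed

text \<open>The same inequality for \<open>u, v\<close> on a great circle avoiding the poles. Such a circle is a graph over
\<open>\<theta>\<close>, and \<open>\<kappa> = cot \<phi>\<close> is a solution of \<open>\<kappa>'' = - \<kappa>\<close>. The curve \<open>(cos \<theta>, sin \<theta>, \<kappa> \<theta>)\<close>, a rescaling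
of the circle, solves the same equation; hence the derivative of \<open>X \<bullet> u\<close> is \<open>sin (\<theta>1 - \<theta>)\<close> times a
nonnegative curvature term.\<close>

lemma curve_le:
  assumes r: "sup_norm a + sup_norm b + sup_norm c \<le> r"
    and \<phi>0: "0 < \<phi>0" "\<phi>0 < pi" and \<phi>1: "0 < \<phi>1" "\<phi>1 < pi"
    and near: "\<bar>\<theta>0 - \<theta>1\<bar> < pi" and ne: "\<theta>0 \<noteq> \<theta>1"
  shows "X r X0 \<phi>0 \<theta>0 \<bullet> vecU \<phi>1 \<theta>1 \<le> X r X0 \<phi>1 \<theta>1 \<bullet> vecU \<phi>1 \<theta>1"
proof -
  \<comment> \<open>The cotangents of the two polar angles, in a form that inverts \<open>arctan\<close> directly.\<close>
  define k0 where "k0 = tan (pi / 2 - \<phi>0)"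
  define k1 where "k1 = tan (pi / 2 - \<phi>1)"
  define S where "S = sin (\<theta>1 - \<theta>0)"
  have S: "S \<noteq> 0"
    using near ne sin_eq_0_pi[of "\<theta>1 - \<theta>0"] by (auto simp: S_def abs_less_iff)
  define \<kappa> where "\<kappa> = (\<lambda>t. (k0 * sin (\<theta>1 - t) + k1 * sin (t - \<theta>0)) / S)"
  define \<kappa>' where "\<kappa>' = (\<lambda>t. (- k0 * cos (\<theta>1 - t) + k1 * cos (t - \<theta>0)) / S)"
  define u where "u = (\<lambda>t. pi / 2 - arctan (\<kappa> t))"
  have \<kappa>_deriv: "(\<kappa> has_real_derivative \<kappa>' t) (at t)" for t
    unfolding \<kappa>_def \<kappa>'_def using S by (auto intro!: derivative_eq_intros simp: field_simps)
  have u01: "u \<theta>0 = \<phi>0" "u \<theta>1 = \<phi>1"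
    using S \<phi>0 \<phi>1 unfolding u_def \<kappa>_def k0_def k1_def
    by (simp_all add: arctan_tan flip: S_def)
  have u_range: "0 < u t" "u t < pi" for t
    using arctan_bounded[of "\<kappa> t"] by (auto simp: u_def)
  have sin_pos: "0 < sin (u t)" for t
    using u_range by (rule sin_gt_zero)
  have cos_u: "cos (u t) = \<kappa> t * sin (u t)" for t
    by (simp add: u_def cos_diff sin_diff cos_arctan sin_arctan)
  have u_deriv: "(u has_real_derivative - \<kappa>' t * (sin (u t))\<^sup>2) (at t)" for t
  proof -
    have "(sin (u t))\<^sup>2 = 1 / (1 + (\<kappa> t)\<^sup>2)"
      by (simp add: u_def sin_diff cos_arctan power_divide)
    moreover have "(u has_real_derivative 0 - inverse (1 + (\<kappa> t)\<^sup>2) * \<kappa>' t) (at t)"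
      unfolding u_def by (intro DERIV_diff DERIV_const DERIV_chain2[OF DERIV_arctan] \<kappa>_deriv)
    ultimately show ?thesis by (simp add: divide_inverse mult.commute)
  qed
  \<comment> \<open>The value at \<open>\<theta>1\<close> of the solution of \<open>\<kappa>'' = - \<kappa>\<close>, expressed by its data at \<open>t\<close>.\<close>
  have k1: "k1 = \<kappa> t * cos (\<theta>1 - t) + \<kappa>' t * sin (\<theta>1 - t)" for t
  proof -
    have "\<kappa> t * cos (\<theta>1 - t) + \<kappa>' t * sin (\<theta>1 - t)
        = k1 * (sin (t - \<theta>0) * cos (\<theta>1 - t) + cos (t - \<theta>0) * sin (\<theta>1 - t)) / S"
      unfolding \<kappa>_def \<kappa>'_def by (simp add: add_divide_distrib diff_divide_distrib algebra_simps)
    also have "sin (t - \<theta>0) * cos (\<theta>1 - t) + cos (t - \<theta>0) * sin (\<theta>1 - t) = S"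
      unfolding S_def by (simp flip: sin_add)
    finally show ?thesis using S by simp
  qed
  \<comment> \<open>The height of the curve in the direction \<open>vecU \<phi>1 \<theta>1\<close>, divided by \<open>sin \<phi>1\<close>.\<close>
  define f where "f = (\<lambda>t. X0 \<bullet> vector [cos \<theta>1, sin \<theta>1, k1]
     + (r * sin (u t) - cos_prim a (u t) t) * cos (\<theta>1 - t) + tang b (u t) t * sin (\<theta>1 - t)
     - (r * (1 - cos (u t)) - sin_prim a (u t) t) * k1)"
  have f: "X r X0 (u t) t \<bullet> vecU \<phi>1 \<theta>1 = sin \<phi>1 * f t" for t
  proof -
    have "vecU \<phi>1 \<theta>1 = sin \<phi>1 *\<^sub>R vector [cos \<theta>1, sin \<theta>1, k1]"
      using cos_u[of \<theta>1] by (simp add: vec_eq_iff forall_3 vec_simps u01)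
        (simp add: \<kappa>_def S_def[symmetric] S)
    moreover have "X r X0 (u t) t \<bullet> vector [cos \<theta>1, sin \<theta>1, k1] = f t"
      unfolding f_def surf_def vec_simps cos_diff sin_diff by algebra
    ultimately show ?thesis by simp
  qed
  define R where "R = (\<lambda>t. r * sin (u t) - cos_prim a (u t) t + tang c (u t) t
     + (r - a (u t, t)) * (\<kappa>' t)\<^sup>2 * sin (u t) ^ 3 + 2 * \<kappa>' t * sin_prim b (u t) t)"
  have R: "0 \<le> R t" for t
    unfolding R_def by (rule curvature_nonneg[OF r u_range])
  have f': "(f has_real_derivative sin (\<theta>1 - t) * R t) (at t)" for t
  proof -
    define s u' \<eta> A Cb Sb where defs: "s = sin (u t)" "u' = - \<kappa>' t * s\<^sup>2" "\<eta> = tang b (u t) t"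
      "A = a (u t, t)" "Cb = cos_prim b (u t) t" "Sb = sin_prim b (u t) t"
    have u': "(u has_real_derivative u') (at t)"
      using u_deriv by (simp add: defs)
    have s: "0 < s" using sin_pos by (simp add: defs)
    have "s * \<eta> = \<kappa> t * s * Sb - s * Cb"
      using sin_times_tang[OF bal_b, of "u t" t] by (simp add: defs cos_u)
    then have "s * (\<eta> - (\<kappa> t * Sb - Cb)) = 0" by algebra
    \<comment> \<open>In the derivative of \<open>f\<close>, this makes the coefficient of \<open>cos (\<theta>1 - t)\<close> vanish.\<close>
    then have \<eta>: "\<eta> = \<kappa> t * Sb - Cb" using s by simp
    have h: "tang_phi b (u t) t * u' = \<kappa>' t * Sb"
      using s by (simp add: tang_phi_def defs)
    have "(f has_real_derivative
        (r * cos (u t) * u' - (A * cos (u t) * u' + Cb)) * cos (\<theta>1 - t)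
        + (r * s - cos_prim a (u t) t) * sin (\<theta>1 - t)
        + (\<kappa>' t * Sb + tang c (u t) t) * sin (\<theta>1 - t) - \<eta> * cos (\<theta>1 - t)
        - (r * s * u' - (A * s * u' + Sb)) * k1) (at t)"
      unfolding f_def h[symmetric]
      by (auto intro!: derivative_eq_intros DERIV_tang_along DERIV_cos_prim_along DERIV_sin_prim_along u'
          simp: defs(1,3-) algebra_simps)
    also have "(r * cos (u t) * u' - (A * cos (u t) * u' + Cb)) * cos (\<theta>1 - t)
        + (r * s - cos_prim a (u t) t) * sin (\<theta>1 - t)
        + (\<kappa>' t * Sb + tang c (u t) t) * sin (\<theta>1 - t) - \<eta> * cos (\<theta>1 - t)
        - (r * s * u' - (A * s * u' + Sb)) * k1 = sin (\<theta>1 - t) * R t"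
      unfolding R_def k1[of t] \<eta> cos_u[of t] defs(1)[symmetric] defs(4)[symmetric] defs(6)[symmetric]
      unfolding defs(2) by algebra
    finally show ?thesis .
  qed
  have "f \<theta>0 \<le> f \<theta>1"
  proof (cases "\<theta>0 \<le> \<theta>1")
    case True
    then show ?thesis
    proof (rule DERIV_nonneg_imp_nondecreasing)
      fix x assume "\<theta>0 \<le> x" "x \<le> \<theta>1"
      then have "0 \<le> sin (\<theta>1 - x)" using near by (intro sin_ge_zero) auto
      then show "\<exists>y. (f has_real_derivative y) (at x) \<and> 0 \<le> y"
        using f' R by (blast intro: mult_nonneg_nonneg)
    qed
  next
    case False
    then have "\<theta>1 \<le> \<theta>0" by simp
    then show ?thesis
    proof (rule DERIV_nonpos_imp_nonincreasing)
      fix x assume "\<theta>1 \<le> x" "x \<le> \<theta>0"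
      then have "0 \<le> sin (x - \<theta>1)" using near by (intro sin_ge_zero) auto
      then have "sin (\<theta>1 - x) \<le> 0" using sin_minus[of "x - \<theta>1"] by simp
      then show "\<exists>y. (f has_real_derivative y) (at x) \<and> y \<le> 0"
        using f' R by (blast intro: mult_nonpos_nonneg)
    qed
  qed
  then have "sin \<phi>1 * f \<theta>0 \<le> sin \<phi>1 * f \<theta>1"
    using sin_pos[of \<theta>1] by (simp add: u01)
  then show ?thesis
    using f[of \<theta>0] f[of \<theta>1] by (simp add: u01)
qed

text \<open>The surface lies below each of its support planes.\<close>

lemma surf_inner_le:
  assumes r: "sup_norm a + sup_norm b + sup_norm c \<le> r"
  shows "X r X0 \<phi>0 \<theta>0 \<bullet> vecU \<phi>1 \<theta>1 \<le> supp a r X0 \<phi>1 \<theta>1"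
proof -
  have ra: "sup_norm a \<le> r" using r sup_norm_nonneg by linarith
  note inv = sphere_inv_surf[of r X0]
  have core: "X r X0 p0 t0 \<bullet> vecU p1 t1 \<le> X r X0 p1 t1 \<bullet> vecU p1 t1"
    if p0: "0 \<le> p0" "p0 \<le> pi" and p1: "0 \<le> p1" "p1 \<le> pi" and t: "\<bar>t0 - t1\<bar> \<le> pi" for p0 t0 p1 t1
  proof -
    have near: "\<bar>p0 - p1\<bar> \<le> pi" using p0 p1 by linarith
    \<comment> \<open>On a common meridian, or with one point at a pole, the meridian estimate applies.\<close>
    consider "t0 = t1" | "t0 = t1 + pi \<or> t1 = t0 + pi" | "sin p0 = 0" | "sin p1 = 0"
      | "0 < p0" "p0 < pi" "0 < p1" "p1 < pi" "t0 \<noteq> t1" "\<bar>t0 - t1\<bar> < pi"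
      using p0 p1 t by (force simp: abs_le_iff abs_less_iff)
    then show ?thesis
    proof cases
      case 1
      then show ?thesis using meridian_le[OF ra near] by simp
    next
      case 2
      have "X r X0 p0 t0 = X r X0 (- p0) t1"
        using 2 sphere_invD(2)[OF inv, of "- p0" t1] sphere_invD(2)[OF inv, of p0 t0] by auto
      moreover have "X r X0 (- p0) t1 = X r X0 (- p0 + 2 * pi) t1"
        using sphere_invD(1)[OF inv, of "- p0" t1] by simp
      moreover have "\<bar>- p0 - p1\<bar> \<le> pi \<or> \<bar>(- p0 + 2 * pi) - p1\<bar> \<le> pi"
        using p0 p1 by linarith
      ultimately show ?thesis
        using meridian_le[OF ra] by metis
    next
      case 3
      then show ?thesis
        using meridian_le[OF ra near, of X0 t1] surf_pole[OF 3, of r X0 t0 t1] by simp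
    next
      case 4
      then have "vecU p1 t1 = vecU p1 t0" by (simp add: vecU_def)
      then show ?thesis
        using meridian_le[OF ra near, of X0 t0] surf_pole[OF 4, of r X0 t0 t1] by simp
    next
      case 5
      then show ?thesis using curve_le[OF r] by blast
    qed
  qed
  obtain p1 t1 where 1: "0 \<le> p1" "p1 \<le> pi"
    "(vecU p1 t1, X r X0 p1 t1) = (vecU \<phi>1 \<theta>1, X r X0 \<phi>1 \<theta>1)"
    by (rule sphere_inv_reduce_phi[OF inv])
  obtain p0 t0 where 0: "0 \<le> p0" "p0 \<le> pi" "\<bar>t0 - t1\<bar> \<le> pi"
    "(vecU p0 t0, X r X0 p0 t0) = (vecU \<phi>0 \<theta>0, X r X0 \<phi>0 \<theta>0)"
    by (rule sphere_inv_reduce_phi[OF inv])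
  have "X r X0 \<phi>0 \<theta>0 \<bullet> vecU \<phi>1 \<theta>1 \<le> X r X0 \<phi>1 \<theta>1 \<bullet> vecU \<phi>1 \<theta>1"
    using core[OF 0(1,2) 1(1,2) 0(3)] 0(4) 1(3) by simp
  then show ?thesis by (simp only: surf_inner_vecU)
qed

end

section \<open>The body, uniqueness, and regularity of the tangential term\<close>

lemma sphere_periodicI:
  assumes "sphere_inv (\<lambda>\<phi> \<theta>. f (\<phi>, \<theta>))" shows "sphere_periodic f"
proof -
  have shift: "f (\<phi>', \<theta>') = f (\<phi>, \<theta>)"
    if 1: "\<phi>' - \<phi> \<in> two_pi_ints" and 2: "\<theta>' - \<theta> \<in> two_pi_ints" for \<phi> \<theta> \<phi>' \<theta>'
  proof -
    obtain k :: int where "\<phi>' - \<phi> = 2 * pi * of_int k"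
      using 1 unfolding two_pi_ints_def by blast
    moreover obtain l :: int where "\<theta>' - \<theta> = 2 * pi * of_int l"
      using 2 unfolding two_pi_ints_def by blast
    ultimately have "\<phi>' = \<phi> + of_int k * (2 * pi)" "\<theta>' = \<theta> + of_int l * (2 * pi)"
      by (simp_all add: algebra_simps)
    then show ?thesis
      using sphere_inv_shift(1)[OF assms, of \<phi> k \<theta>'] sphere_inv_shift(2)[OF assms, of \<phi> \<theta> l] by simp
  qed
  have "f (\<phi>', \<theta>') = f (\<phi>, \<theta>)"
    if "\<phi>' + \<phi> \<in> two_pi_ints" "\<theta>' - \<theta> + pi \<in> two_pi_ints" for \<phi> \<theta> \<phi>' \<theta>'
  proof -
    have "f (\<phi>', \<theta>') = f (- \<phi>, \<theta> - pi)"
      by (rule shift) (use that in \<open>simp_all add: algebra_simps\<close>)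
    also have "\<dots> = f (\<phi>, \<theta>)"
      using sphere_invD(2)[OF assms, of "- \<phi>" "\<theta> - pi"] by simp
    finally show ?thesis .
  qed
  with shift show ?thesis
    unfolding sphere_periodic_def by blast
qed

context width_data
begin

text \<open>The coefficient of \<open>vecW\<close>, extended to the whole plane.\<close>

definition h :: "real \<times> real \<Rightarrow> real" where
  "h p = tang b (fst p) (snd p)"

lemma surface_param_h: "p \<in> param_domain \<Longrightarrow> surface_param a h r X0 p = X r X0 (fst p) (snd p)"
  by (cases p) (simp add: surface_param_eq_surf[OF cont_a] param_domain_def h_def)

lemma surface_param_image_eq_range: "surface_param a h r X0 ` param_domain = range (\<lambda>p. X r X0 (fst p) (snd p))"
proof -
  have "X r X0 \<phi> \<theta> \<in> surface_param a h r X0 ` param_domain" for \<phi> \<theta>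
  proof -
    obtain \<phi>' \<theta>' where "(\<phi>', \<theta>') \<in> param_domain"
      "(vecU \<phi>' \<theta>', X r X0 \<phi>' \<theta>') = (vecU \<phi> \<theta>, X r X0 \<phi> \<theta>)"
      by (rule sphere_inv_reduce[OF sphere_inv_surf])
    then show ?thesis
      using surface_param_h[of "(\<phi>', \<theta>')"] by (intro rev_image_eqI[of "(\<phi>', \<theta>')"]) auto
  qed
  then show ?thesis
    by (intro equalityI image_subsetI) (simp_all add: surface_param_h)
qed

lemma continuous_on_surf: "continuous_on S (\<lambda>p. X r X0 (fst p) (snd p))"
proof -
  have "continuous_on UNIV (\<lambda>p. X r X0 (fst p) (snd p) $ i)" for i
    using exhaust_3[of i]
    by (elim disjE; simp only: surf_def vec_simps;
        intro continuous_intros continuous_on_tang[OF bal_b] continuous_on_cos_prim[OF cont_a]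
          continuous_on_sin_prim[OF cont_a])
  then have "continuous_on UNIV (\<lambda>p. \<chi> i. X r X0 (fst p) (snd p) $ i)"
    by (intro continuous_on_vec_lambda)
  then have "continuous_on UNIV (\<lambda>p. X r X0 (fst p) (snd p))"
    by simp
  then show ?thesis
    by (rule continuous_on_subset) simp
qed

text \<open>The body is the convex hull of the surface. Its support function is \<open>supp\<close>, so its width is
constant by \<open>supp_antipodal\<close>, and \<open>face_unique\<close> shows that each boundary point lies on the surface.\<close>

lemma surf_is_boundary:
  assumes r: "sup_norm a + sup_norm b + sup_norm c \<le> r"
  shows "is_boundary_of_constant_width_body (surface_param a h r X0 ` param_domain) (2 * r)"
proof -
  define B where "B = surface_param a h r X0 ` param_domain"
  define G where "G = convex hull B"
  have BI: "X r X0 \<phi> \<theta> \<in> B" for \<phi> \<theta>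
    unfolding B_def surface_param_image_eq_range by (intro range_eqI[of _ _ "(\<phi>, \<theta>)"]) simp
  then have GI: "X r X0 \<phi> \<theta> \<in> G" for \<phi> \<theta>
    unfolding G_def by (rule hull_inc)
  have "B = (\<lambda>p. X r X0 (fst p) (snd p)) ` param_domain"
    unfolding B_def by (rule image_cong[OF refl surface_param_h])
  then have "compact B"
    by (auto simp: param_domain_def intro!: compact_continuous_image continuous_on_surf compact_Times)
  then have G: "compact G" "convex G"
    unfolding G_def by (auto intro: compact_convex_hull)
  have le: "x \<bullet> vecU \<phi> \<theta> \<le> supp a r X0 \<phi> \<theta>" if "x \<in> G" for x \<phi> \<theta>
  proof -
    have "vecU \<phi> \<theta> \<bullet> X r X0 \<phi>0 \<theta>0 \<le> supp a r X0 \<phi> \<theta>" for \<phi>0 \<theta>0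
      by (subst inner_commute) (rule surf_inner_le[OF r])
    then have "B \<subseteq> {x. vecU \<phi> \<theta> \<bullet> x \<le> supp a r X0 \<phi> \<theta>}"
      unfolding B_def surface_param_image_eq_range by auto
    then have "G \<subseteq> {x. vecU \<phi> \<theta> \<bullet> x \<le> supp a r X0 \<phi> \<theta>}"
      unfolding G_def by (rule hull_minimal) (rule convex_halfspace_le)
    then show ?thesis using that by (auto simp: inner_commute)
  qed
  have ge: "supp a r X0 \<phi> \<theta> - 2 * r \<le> x \<bullet> vecU \<phi> \<theta>" if "x \<in> G" for x \<phi> \<theta>
    using le[OF that, of "\<phi> + pi" \<theta>] by (simp add: vecU_sym supp_antipodal)
  have "directional_width G \<omega> = 2 * r" if unit: "\<omega> \<in> sphere 0 1" for \<omega>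
  proof -
    obtain \<phi> \<theta> where \<omega>: "\<omega> = vecU \<phi> \<theta>"
      by (rule unit_eq_vecU[of \<omega>]) (use unit in auto)
    have "(SUP x\<in>G. \<omega> \<bullet> x) = supp a r X0 \<phi> \<theta>"
    proof (rule cSup_eq_maximum)
      show "supp a r X0 \<phi> \<theta> \<in> (\<bullet>) \<omega> ` G"
        using GI[of \<phi> \<theta>] surf_inner_vecU[of a r X0 "tang b \<phi> \<theta>" \<phi> \<theta>]
        by (intro rev_image_eqI) (auto simp: \<omega> inner_commute)
    qed (use le in \<open>auto simp: \<omega> inner_commute\<close>)
    moreover have "(INF x\<in>G. \<omega> \<bullet> x) = supp a r X0 \<phi> \<theta> - 2 * r"
    proof (rule cInf_eq_minimum)
      show "supp a r X0 \<phi> \<theta> - 2 * r \<in> (\<bullet>) \<omega> ` G"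
        using GI[of "\<phi> + pi" \<theta>] surf_inner_vecU[of a r X0 "tang b (\<phi> + pi) \<theta>" "\<phi> + pi" \<theta>]
        by (intro rev_image_eqI) (auto simp: \<omega> inner_commute vecU_sym supp_antipodal)
    qed (use ge in \<open>auto simp: \<omega> inner_commute\<close>)
    ultimately show ?thesis by (simp add: directional_width_def)
  qed
  then have "constant_width_body G (2 * r)"
    using G GI by (auto simp: constant_width_body_def)
  moreover have "B = frontier G"
  proof (intro equalityI subsetI)
    fix y assume "y \<in> B"
    then obtain \<phi> \<theta> where y: "y = X r X0 \<phi> \<theta>"
      unfolding B_def surface_param_image_eq_range by auto
    have "y \<notin> interior G"
    proof
      assume "y \<in> interior G"
      then obtain e where e: "e > 0" "cball y e \<subseteq> G"
        by (auto simp: mem_interior_cball)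
      then have "y + e *\<^sub>R vecU \<phi> \<theta> \<in> G"
        by (intro subsetD[OF e(2)]) (simp add: dist_norm norm_vecU)
      from le[OF this, of \<phi> \<theta>] have "e * (vecU \<phi> \<theta> \<bullet> vecU \<phi> \<theta>) \<le> 0"
        by (simp add: y inner_add_left surf_inner_vecU)
      then show False
        using e(1) norm_vecU[of \<phi> \<theta>] by (simp add: norm_eq_1)
    qed
    then show "y \<in> frontier G"
      using GI y closure_subset[of G] by (auto simp: frontier_def)
  next
    fix y assume "y \<in> frontier G"
    then have yG: "y \<in> G" and yI: "y \<notin> interior G"
      using G(1) by (auto simp: frontier_def closure_closed compact_imp_closed)
    obtain v where v: "v \<noteq> 0" "\<And>x. x \<in> G \<Longrightarrow> v \<bullet> x \<le> v \<bullet> y"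
    \<comment> \<open>An empty interior does occur: for \<open>r = 0\<close> the body is a single point.\<close>
    proof (cases "interior G = {}")
      case True
      then obtain v \<beta> where "v \<noteq> 0" "G \<subseteq> {x. v \<bullet> x = \<beta>}"
        by (rule empty_interior_subset_hyperplane[OF G(2)])
      moreover from this have "v \<bullet> x = \<beta>" if "x \<in> G" for x
        using that by auto
      ultimately show ?thesis using yG by (intro that[of v]) simp_all
    next
      case False
      have cl: "closure G = G"
        using G(1) by (simp add: closure_closed compact_imp_closed)
      have yC: "y \<in> closure G" and yR: "y \<notin> rel_interior G"
        using yG yI False by (simp_all add: cl rel_interior_nonempty_interior)
      obtain v where "v \<noteq> 0" "\<And>x. x \<in> closure G \<Longrightarrow> v \<bullet> y \<le> v \<bullet> x"
        by (rule supporting_hyperplane_relative_frontier[OF G(2) yC yR], rule that)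
      then show ?thesis
        by (intro that[of "- v"]) (simp_all add: cl)
    qed
    obtain \<phi> \<theta> where u: "v /\<^sub>R norm v = vecU \<phi> \<theta>"
      by (rule unit_eq_vecU[of "v /\<^sub>R norm v"]) (use v(1) in auto)
    have "vecU \<phi> \<theta> \<bullet> X r X0 \<phi> \<theta> \<le> vecU \<phi> \<theta> \<bullet> y"
      unfolding u[symmetric] using v(2)[OF GI] by (simp add: divide_right_mono mult_left_mono)
    then have "supp a r X0 \<phi> \<theta> \<le> y \<bullet> vecU \<phi> \<theta>"
      using surf_inner_vecU[of a r X0 "tang b \<phi> \<theta>" \<phi> \<theta>] by (simp add: inner_commute)
    then have "y = X r X0 \<phi> \<theta>"
      using le[OF yG] by (intro face_unique antisym) auto
    then show "y \<in> B" using BI by simp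
  qed
  ultimately show ?thesis
    unfolding is_boundary_of_constant_width_body_def B_def by blast
qed

text \<open>For an arbitrary coefficient \<open>h'\<close>, each point of the surface still has height \<open>supp\<close> over its normal
direction \<open>u\<close>. Thus the support function of the body is at least \<open>supp\<close> in the directions \<open>u\<close> and
\<open>- u\<close>; both sums over the antipodal pair equal \<open>2 * r\<close>, so it equals \<open>supp\<close>, and \<open>face_unique\<close>
determines the point.\<close>

lemma h_unique:
  assumes B: "is_boundary_of_constant_width_body (surface_param a h' r X0 ` param_domain) (2 * r)"
    and p: "p \<in> param_domain"
  shows "h' p = h p"
proof -
  obtain G where cw: "constant_width_body G (2 * r)"
    and BG: "surface_param a h' r X0 ` param_domain = frontier G"
    using B unfolding is_boundary_of_constant_width_body_def by blast
  from cw have G: "compact G" "\<And>\<omega>. \<omega> \<in> sphere 0 1 \<Longrightarrow> directional_width G \<omega> = 2 * r"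
    unfolding constant_width_body_def by blast+
  define Y where "Y = (\<lambda>\<phi> \<theta>. surf a r X0 (h' (\<phi>, \<theta>)) \<phi> \<theta>)"
  have YG: "Y \<phi> \<theta> \<in> G" if "(\<phi>, \<theta>) \<in> param_domain" for \<phi> \<theta>
  proof -
    have "surface_param a h' r X0 (\<phi>, \<theta>) \<in> frontier G"
      using that BG by blast
    then show ?thesis
      using that G(1) surface_param_eq_surf[OF cont_a, of \<phi> h' r X0 \<theta>]
      by (auto simp: frontier_def closure_closed compact_imp_closed Y_def param_domain_def)
  qed
  have bdd: "bdd_above ((\<bullet>) \<omega> ` G)" "bdd_below ((\<bullet>) \<omega> ` G)" for \<omega>
  proof -
    have "bounded ((\<bullet>) \<omega> ` G)"
      by (intro compact_imp_bounded compact_continuous_image continuous_intros G)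
    then show "bdd_above ((\<bullet>) \<omega> ` G)" "bdd_below ((\<bullet>) \<omega> ` G)"
      by (auto intro: bounded_imp_bdd_above bounded_imp_bdd_below)
  qed
  have le_dom: "x \<bullet> vecU \<phi> \<theta> \<le> supp a r X0 \<phi> \<theta>" if x: "x \<in> G" and dom: "(\<phi>, \<theta>) \<in> param_domain" for x \<phi> \<theta>
  proof -
    define \<phi>' where "\<phi>' = (if \<phi> \<le> pi then \<phi> + pi else \<phi> - pi)"
    have dom': "(\<phi>', \<theta>) \<in> param_domain"
      using dom by (auto simp: \<phi>'_def param_domain_def)
    have anti: "vecU \<phi>' \<theta> = - vecU \<phi> \<theta>" "supp a r X0 \<phi>' \<theta> = 2 * r - supp a r X0 \<phi> \<theta>"
      using vecU_sym(3)[of "\<phi> - pi" \<theta>] supp_antipodal[of r X0 "\<phi> - pi" \<theta>]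
      by (auto simp: \<phi>'_def vecU_sym supp_antipodal)
    let ?u = "vecU \<phi> \<theta>"
    have "(INF x\<in>G. ?u \<bullet> x) \<le> ?u \<bullet> Y \<phi>' \<theta>"
      by (rule cINF_lower[OF bdd(2) YG[OF dom']])
    also have "\<dots> = supp a r X0 \<phi> \<theta> - 2 * r"
      using surf_inner_vecU[of a r X0 "h' (\<phi>', \<theta>)" \<phi>' \<theta>] by (simp add: Y_def anti inner_commute)
    finally have "(SUP x\<in>G. ?u \<bullet> x) \<le> supp a r X0 \<phi> \<theta>"
      using G(2)[of ?u] by (simp add: directional_width_def norm_vecU)
    moreover have "?u \<bullet> x \<le> (SUP x\<in>G. ?u \<bullet> x)"
      by (rule cSUP_upper[OF x bdd(1)])
    ultimately show ?thesis by (simp add: inner_commute)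
  qed
  have le: "x \<bullet> vecU \<phi> \<theta> \<le> supp a r X0 \<phi> \<theta>" if x: "x \<in> G" for x \<phi> \<theta>
  proof -
    obtain \<phi>' \<theta>' where "(\<phi>', \<theta>') \<in> param_domain"
      "(vecU \<phi>' \<theta>', supp a r X0 \<phi>' \<theta>') = (vecU \<phi> \<theta>, supp a r X0 \<phi> \<theta>)"
      by (rule sphere_inv_reduce[OF sphere_inv_supp])
    then show ?thesis using le_dom[OF x, of \<phi>' \<theta>'] by simp
  qed
  obtain \<phi> \<theta> where p': "p = (\<phi>, \<theta>)" by (cases p)
  have "Y \<phi> \<theta> = X r X0 \<phi> \<theta>"
    by (rule face_unique) (use le YG p p' in \<open>auto simp: Y_def surf_inner_vecU\<close>)
  then have "Y \<phi> \<theta> $ 1 = X r X0 \<phi> \<theta> $ 1" "Y \<phi> \<theta> $ 2 = X r X0 \<phi> \<theta> $ 2"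
    by simp_all
  then have "(h' p - h p) * sin \<theta> = 0" "(h' p - h p) * cos \<theta> = 0"
    by (auto simp: Y_def surf_def vec_simps h_def p')
  then have "(h' p - h p) * ((sin \<theta>)\<^sup>2 + (cos \<theta>)\<^sup>2) = 0"
    by algebra
  then show ?thesis by simp
qed

lemma h_eq_formula:
  assumes \<phi>: "0 < \<phi>" "\<phi> < pi" and b: "b = partial_theta a"
  shows "h (\<phi>, \<theta>) = h_formula a \<phi> \<theta>"
proof -
  have "((\<lambda>s. sin \<phi> * (b (s, \<theta>) * cos s) - cos \<phi> * (b (s, \<theta>) * sin s)) has_integral
      sin \<phi> * cos_prim b \<phi> \<theta> - cos \<phi> * sin_prim b \<phi> \<theta>) {0..\<phi>}"
    using \<phi> by (intro has_integral_diff has_integral_mult_right has_integral_cos_prim[OF cont_b]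
        has_integral_sin_prim[OF cont_b]) auto
  also have "(\<lambda>s. sin \<phi> * (b (s, \<theta>) * cos s) - cos \<phi> * (b (s, \<theta>) * sin s))
      = (\<lambda>s. sin (\<phi> - s) * b (s, \<theta>))"
    by (simp add: fun_eq_iff sin_diff algebra_simps)
  finally have "integral {0..\<phi>} (\<lambda>s. sin (\<phi> - s) * b (s, \<theta>))
      = sin \<phi> * cos_prim b \<phi> \<theta> - cos \<phi> * sin_prim b \<phi> \<theta>"
    by (rule integral_unique)
  moreover have "sin \<phi> \<noteq> 0"
    using sin_gt_zero[OF \<phi>] by simp
  ultimately show ?thesis
    by (simp add: h_formula_def h_def tang_def minus_divide_left flip: b)
qed

text \<open>The coefficient \<open>h\<close> changes sign under \<open>(\<phi>, \<theta>) \<mapsto> (- \<phi>, \<theta> + pi)\<close>; only its product with a factor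
that does the same is a function on the sphere.\<close>

lemma h_times_C_k_pc:
  assumes w: "\<And>t. (w has_real_derivative w' t) (at t)" and cw: "continuous_on UNIV w'"
    and anti: "\<And>t. w (t + pi) = - w t"
  shows "(\<lambda>p. h p * w (snd p)) \<in> C_k_pc 1"
proof -
  have cont_w: "continuous_on UNIV w"
    using w by (intro DERIV_continuous_on) (auto intro: has_field_derivative_at_within)
  have "(\<lambda>p. tang b (fst p) (snd p) * w (snd p)) \<in> C_k 1"
  proof (rule C_k_1_I)
    show "((\<lambda>x. tang b x y * w y) has_real_derivative tang_phi b x y * w y) (at x)" for x y
      by (rule DERIV_cmult_right[OF DERIV_tang_phi[OF bal_b]])
    show "((\<lambda>y. tang b x y * w y) has_real_derivative tang c x y * w y + w' y * tang b x y) (at y)" for x y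
      by (rule DERIV_mult[OF DERIV_tang_theta[OF cont_b cont_c DERIV_b] w])
    show "continuous_on UNIV (\<lambda>p. tang_phi b (fst p) (snd p) * w (snd p))"
      by (intro continuous_intros continuous_on_tang_phi[OF bal_b] continuous_on_compose2[OF cont_w]) auto
    show "continuous_on UNIV (\<lambda>p. tang c (fst p) (snd p) * w (snd p) + w' (snd p) * tang b (fst p) (snd p))"
      by (intro continuous_intros continuous_on_tang[OF bal_b] continuous_on_tang[OF bal_c]
          continuous_on_compose2[OF cont_w] continuous_on_compose2[OF cw]) auto
  qed
  moreover have "sphere_periodic (\<lambda>p. h p * w (snd p))"
    by (rule sphere_periodicI)
       (simp add: sphere_inv_def h_def prim_plus_2pi[OF bal_b] tang_flip[OF bal_b] anti)
  ultimately show ?thesis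
    by (simp add: C_k_pc_def pole_compatible_def h_def)
qed

lemma h_vecW_in_C_k_pc_vec: "(\<lambda>(\<phi>, \<theta>). h (\<phi>, \<theta>) *\<^sub>R vecW \<theta>) \<in> C_k_pc_vec 1"
proof -
  have "(\<lambda>p. h p * - sin (snd p)) \<in> C_k_pc 1"
    by (rule h_times_C_k_pc[of _ "\<lambda>t. - cos t"]) (auto intro!: derivative_eq_intros continuous_intros)
  moreover have "(\<lambda>p. h p * cos (snd p)) \<in> C_k_pc 1"
    by (rule h_times_C_k_pc[of _ "\<lambda>t. - sin t"]) (auto intro!: derivative_eq_intros continuous_intros)
  moreover have "(\<lambda>p. h p * 0) \<in> C_k_pc 1"
    by (rule h_times_C_k_pc[of "\<lambda>_. 0" "\<lambda>_. 0"]) auto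
  ultimately show ?thesis
    by (simp add: C_k_pc_vec_def forall_3 vecW_def vector_3 case_prod_beta')
qed

end

lemma width_data_partial_theta:
  assumes a_C2p: "a \<in> C_k_p 2"
    and a_antisym: "\<forall>\<phi> \<theta>. a (\<phi>, \<theta>) = - a (\<phi> + pi, \<theta>)"
    and a_int: "\<forall>\<theta>. integral {0..pi} (\<lambda>s. a (s, \<theta>) *\<^sub>R (vector [cos s, sin s] :: real^2)) = vector [0, 0]"
  shows "width_data a (partial_theta a) (partial_theta (partial_theta a))"
proof
  have a: "a differentiable_on UNIV" "partial_theta a differentiable_on UNIV"
    "continuous_on UNIV (partial_theta (partial_theta a))" and per: "sphere_periodic a"
    using a_C2p by (auto simp: C_k_p_def numeral_2_eq_2)
  then have cont: "continuous_on UNIV a"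
    by (intro differentiable_imp_continuous_on)
  show "continuous_on UNIV (partial_theta a)"
    by (rule differentiable_imp_continuous_on[OF a(2)])
  show "continuous_on UNIV (partial_theta (partial_theta a))" by (rule a(3))
  show "((\<lambda>t. a (\<phi>, t)) has_real_derivative partial_theta a (\<phi>, \<theta>)) (at \<theta>)" for \<phi> \<theta>
    by (rule partial_theta_DERIV[OF a(1)])
  show "((\<lambda>t. partial_theta a (\<phi>, t)) has_real_derivative partial_theta (partial_theta a) (\<phi>, \<theta>)) (at \<theta>)" for \<phi> \<theta>
    by (rule partial_theta_DERIV[OF a(2)])
  have flip: "a (- \<phi>, \<theta> + pi) = a (\<phi>, \<theta>)" for \<phi> \<theta>
  proof -
    have "0 \<in> two_pi_ints" "2 * pi \<in> two_pi_ints"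
      unfolding two_pi_ints_def by (rule range_eqI[of _ _ 0], simp, rule range_eqI[of _ _ 1], simp)
    then show ?thesis
      using per unfolding sphere_periodic_def by simp
  qed
  have "cos_prim a pi \<theta> = 0 \<and> sin_prim a pi \<theta> = 0" for \<theta>
  proof -
    let ?e1 = "vector [1, 0] :: real^2" and ?e2 = "vector [0, 1] :: real^2"
    have "((\<lambda>s. (a (s, \<theta>) * cos s) *\<^sub>R ?e1 + (a (s, \<theta>) * sin s) *\<^sub>R ?e2) has_integral
        cos_prim a pi \<theta> *\<^sub>R ?e1 + sin_prim a pi \<theta> *\<^sub>R ?e2) {0..pi}"
      by (intro has_integral_add has_integral_scaleR_left has_integral_cos_prim[OF cont]
          has_integral_sin_prim[OF cont]) auto
    also have "(\<lambda>s. (a (s, \<theta>) * cos s) *\<^sub>R ?e1 + (a (s, \<theta>) * sin s) *\<^sub>R ?e2)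
        = (\<lambda>s. a (s, \<theta>) *\<^sub>R vector [cos s, sin s])"
      by (simp add: fun_eq_iff vec_eq_iff forall_2 vector_2)
    finally have "cos_prim a pi \<theta> *\<^sub>R ?e1 + sin_prim a pi \<theta> *\<^sub>R ?e2 = vector [0, 0]"
      using a_int[rule_format, of \<theta>] by (auto dest: integral_unique)
    then show ?thesis
      by (simp add: vec_eq_iff forall_2 vector_2)
  qed
  moreover have "a (\<phi> + pi, \<theta>) = - a (\<phi>, \<theta>)" for \<phi> \<theta>
    using a_antisym by (metis minus_minus)
  ultimately show "balanced a"
    using cont flip by (simp add: balanced_def)
qed

theorem theorem5:
  fixes a :: "real \<times> real \<Rightarrow> real"
  assumes a_C2p: "a \<in> C_k_p 2"
    and a_antisym: "\<forall>\<phi> \<theta>. a (\<phi>, \<theta>) = - a (\<phi> + pi, \<theta>)"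
    and a_int: "\<forall>\<theta>. integral {0..pi} (\<lambda>s. a (s, \<theta>) *\<^sub>R (vector [cos s, sin s] :: real^2)) = vector [0, 0]"
  shows "\<exists>h :: real \<times> real \<Rightarrow> real.
     (continuous_on UNIV h \<and>
      (\<forall>\<phi> \<theta>. 0 < \<phi> \<and> \<phi> < pi \<longrightarrow> h (\<phi>, \<theta>) = h_formula a \<phi> \<theta>) \<and>
      (\<forall>\<phi> \<theta>. h (\<phi>, \<theta>) = h (\<phi> + pi, \<theta>)) \<and>
      (\<forall>(k::int) \<theta>. h (pi * of_int k, \<theta>) = 0) \<and>
      (\<lambda>(\<phi>, \<theta>). h (\<phi>, \<theta>) *\<^sub>R vecW \<theta>) \<in> C_k_pc_vec 1) \<and>
     (\<exists>r0 \<in> {sup_norm a ..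
              sup_norm a + sup_norm (partial_theta a) + sup_norm (partial_theta (partial_theta a))}.
        \<forall>r \<ge> r0. \<forall>X0 :: real^3.
          is_boundary_of_constant_width_body (surface_param a h r X0 ` param_domain) (2 * r)) \<and>
     (\<forall>(r::real) (X0 :: real^3) (h' :: real \<times> real \<Rightarrow> real).
        is_boundary_of_constant_width_body (surface_param a h' r X0 ` param_domain) (2 * r)
        \<longrightarrow> (\<forall>p \<in> param_domain. h' p = h p))"
proof -
  interpret width_data a "partial_theta a" "partial_theta (partial_theta a)"
    by (rule width_data_partial_theta[OF assms])
  show ?thesis
  proof (intro exI[of _ h] conjI allI impI ballI)
    show "continuous_on UNIV h"
      unfolding h_def[abs_def] by (rule continuous_on_tang[OF bal_b])
    show "h (\<phi>, \<theta>) = h_formula a \<phi> \<theta>" if "0 < \<phi> \<and> \<phi> < pi" for \<phi> \<theta>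
      using that by (intro h_eq_formula) auto
    show "h (\<phi>, \<theta>) = h (\<phi> + pi, \<theta>)" for \<phi> \<theta>
      by (simp add: h_def tang_plus_pi[OF bal_b])
    show "h (pi * of_int k, \<theta>) = 0" for k :: int and \<theta>
      by (simp add: h_def sin_times_pi_eq_0 mult.commute[of pi])
    show "(\<lambda>(\<phi>, \<theta>). h (\<phi>, \<theta>) *\<^sub>R vecW \<theta>) \<in> C_k_pc_vec 1"
      by (rule h_vecW_in_C_k_pc_vec)
    \<comment> \<open>The upper end of the interval is taken for \<open>r0\<close>.\<close>
    show "\<exists>r0 \<in> {sup_norm a ..
              sup_norm a + sup_norm (partial_theta a) + sup_norm (partial_theta (partial_theta a))}.
        \<forall>r \<ge> r0. \<forall>X0 :: real^3.
          is_boundary_of_constant_width_body (surface_param a h r X0 ` param_domain) (2 * r)"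
      using surf_is_boundary sup_norm_nonneg
      by (intro bexI[of _ "sup_norm a + sup_norm (partial_theta a) + sup_norm (partial_theta (partial_theta a))"])
         auto
    show "h' p = h p"
      if "is_boundary_of_constant_width_body (surface_param a h' r X0 ` param_domain) (2 * r)"
        "p \<in> param_domain" for r X0 h' p
      using that by (rule h_unique)
  qed
qed

end
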